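(* For all $\epsilon<1$ and $n\in\{2,3\}$ there exist nontrivial functions $$u\in C^\infty(\mathbb{R}^n;\mathbb{C}^N),\qquad \mathbb{V}\in C^\infty(\mathbb{R}^n;\mathbb{C}^{N\times N}),$$ such that for all $x\in\mathbb{R}^n$ (i) $\mathcal{D}_n u(x)=\mathbb{V}(x)u(x)$; (ii) $|u(x)|\leq C_1e^{-C_2|x|^{2-2\epsilon}}$; (iii) $$|\mathbb{V}(x)|\leq\begin{cases} C_3|x|^{-\epsilon}, & \text{for } n=2,\\ C_3|x|^{-\epsilon}(\log|x|)^3, & \text{for } n=3,\end{cases}$$ for some $C_1,C_2,C_3>0$.
   Context: Here $N=2^{\lfloor (n+1)/2\rfloor}$, where $\lfloor\cdot\rfloor$ denotes the integer part, so $N=2$ for $n=2$ and $N=4$ for $n=3$. The Pauli matrices are $$\sigma_1=\begin{pmatrix}0&1\\1&0\end{pmatrix},\quad \sigma_2=\begin{pmatrix}0&-i\\i&0\end{pmatrix},\quad \sigma_3=\begin{pmatrix}1&0\\0&-1\end{pmatrix}.$$ The massless Dirac operator acts on functions $u:\mathbb{R}^n\to\mathbb{C}^N$ by $\mathcal{D}_n u:=-i\sum_{j=1}^n\alpha_j\,\partial_j u$, where for $n=2$ one takes $\alpha_1=\sigma_1$, $\alpha_2=\sigma_2$, and for $n=3$ one takes $$\alpha_j=\begin{pmatrix}0&\sigma_j\\\sigma_j&0\end{pmatrix}\in\mathbb{C}^{4\times4},\quad j=1,2,3.$$ $|u(x)|$ is the Euclidean norm in $\mathbb{C}^N$ and $|\mathbb{V}(x)|$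 is a matrix norm. The matrices $\mathbb{V}(x)$ are not required to be Hermitian.
   Formalization: For n=3 the factor (log|x|)^3 in (iii), negative for 0<|x|<1 so that the printed bound is impossible there, is replaced by |log|x||^3 (identical for |x|≥1); (iii) is stated for x≠0, which loses nothing for n=2 by continuity. *)

theory Defs
  imports "HOL-Analysis.Analysis"
begin

definition partial :: "'n \<Rightarrow> (real^'n \<Rightarrow> 'b::real_normed_vector) \<Rightarrow> real^'n \<Rightarrow> 'b"
  where "partial j f x = frechet_derivative f (at x) (axis j 1)"

primrec C_class :: "nat \<Rightarrow> (real^'n \<Rightarrow> 'b::real_normed_vector) \<Rightarrow> bool"
  where
    "C_class 0 f \<longleftrightarrow> continuous_on UNIV f"
  | "C_class (Suc k) f \<longleftrightarrow>
       (\<forall>x. f differentiable (at x)) \<and> (\<forall>j. C_class k (partial j f))"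

definition smooth :: "(real^'n \<Rightarrow> 'b::real_normed_vector) \<Rightarrow> bool"
  where "smooth f \<longleftrightarrow> (\<forall>k. C_class k f)"

definition pauli1 :: "complex^2^2"
  where "pauli1 = vector [vector [0, 1], vector [1, 0]]"

definition pauli2 :: "complex^2^2"
  where "pauli2 = vector [vector [0, - \<i>], vector [\<i>, 0]]"

definition pauli3 :: "complex^2^2"
  where "pauli3 = vector [vector [1, 0], vector [0, - 1]]"

definition off_diag :: "complex^2^2 \<Rightarrow> complex^4^4"
  where "off_diag s = vector
    [vector [0, 0, s$1$1, s$1$2],
     vector [0, 0, s$2$1, s$2$2],
     vector [s$1$1, s$1$2, 0, 0],
     vector [s$2$1, s$2$2, 0, 0]]"

definition alpha2 :: "(complex^2^2)^2"
  where "alpha2 = vector [pauli1, pauli2]"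

definition alpha3 :: "(complex^4^4)^3"
  where "alpha3 = vector [off_diag pauli1, off_diag pauli2, off_diag pauli3]"

definition dirac ::
    "(complex^'m^'m)^'n \<Rightarrow> (real^'n \<Rightarrow> complex^'m) \<Rightarrow> real^'n \<Rightarrow> complex^'m"
  where "dirac \<alpha> u x = (- \<i>) *s (\<Sum>j\<in>UNIV. \<alpha>$j *v partial j u x)"

(* In the statement, norm on complex^'m is the Euclidean norm, and norm on
   complex^'m^'m is the Frobenius norm; any other matrix norm only changes C3.

   Since 0 powr a = 0 for every a, the pointwise bound on V is stated for x \<noteq> 0.
   Nothing is lost: at x = 0, |x|^(-\<epsilon>) is infinite for \<epsilon> > 0, and for \<epsilon> \<le> 0 a finite
   bound at 0 follows from the others by continuity of V.

   For n = 3 the factor is |log|x||^3: with the sign of log|x| kept, the bound would be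
   negative for 0 < |x| < 1. For |x| \<ge> 1 the two agree. *)

end

theory Submission
  imports Defs
begin

text \<open>
  Put \<open>Y = |x| powr (- \<epsilon>) * x\<close>, so that \<open>|Y|\<^sup>2 = |x| powr (2 - 2 * \<epsilon>)\<close>, and divide \<open>Y\<close>-space into
  cubes of side 4. The preimage of a cube has diameter of order \<open>|x| powr \<epsilon>\<close>, and on this scale
  \<open>exp (- |Y|\<^sup>2)\<close> is comparable to the modulus of an exact null solution of the Dirac operator: a plane
  wave with isotropic complex frequency in space, a negative power of \<open>z\<close> or of its conjugate in the
  plane. Cutting such solutions off at the scale of the cells costs a factor of order
  \<open>|x| powr (- \<epsilon>)\<close> in \<open>D u\<close>, so that \<open>V = D u \<otimes> u\<^sup>* / |u|\<^sup>2\<close> has the right size, provided that the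
  overlapping pieces do not cancel in their sum \<open>u\<close>.

  In space, the four families of cubes obtained by shifting by \<open>c * (1, 1, 1)\<close> for \<open>c = 0, 1, 2, 3\<close>
  cover everything even after their faces are removed, because each of the three coordinates is close
  to a face of at most one family, and \<open>\<complex>\<^sup>4\<close> has room for four families: 0 and 1 live in the upper
  two components, 2 and 3 in the lower two. Within a pair, overlapping pieces have uniformly independent
  spinors, since the frequency of a cell can still be rotated about the radial direction and only eight
  cells have to be avoided. In the plane the cells are annuli, two families suffice, and they occupy one
  component each.

  The coordinate \<open>Y\<close> is cut off to 0 for \<open>|x| < 2\<close>. All cut-offs are constant there, so \<open>u\<close> is an exact
  solution and \<open>V = 0\<close>; this is why neither the origin nor the zero
  of the logarithm at \<open>|x| = 1\<close> causes trouble, and no power of the logarithm is lost.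
\<close>

section \<open>Calculus of smooth functions\<close>

lemma partial_eqI: "(f has_derivative f') (at x) \<Longrightarrow> partial j f x = f' (axis j 1)"
  by (simp add: partial_def frechet_derivative_at[symmetric])

lemma partial_cong:
  assumes "open S" "x \<in> S" "\<And>z. z \<in> S \<Longrightarrow> f z = g z"
  shows "partial j f x = partial j g x"
proof -
  have "(f has_derivative D) (at x) \<longleftrightarrow> (g has_derivative D) (at x)" for D
    using has_derivative_transform_within_open[of f D x UNIV S g]
      has_derivative_transform_within_open[of g D x UNIV S f] assms by auto
  then show ?thesis
    by (simp add: partial_def frechet_derivative_def)
qed

lemma differentiable_cong_open:
  assumes "open S" "x \<in> S" "\<And>z. z \<in> S \<Longrightarrow> f z = g z" "f differentiable (at x)"
  shows "g differentiable (at x)"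
  using assms has_derivative_transform_within_open[of f _ x UNIV S g]
  unfolding differentiable_def by metis

primrec C_class_on :: "nat \<Rightarrow> (real^'n) set \<Rightarrow> (real^'n \<Rightarrow> 'b::real_normed_vector) \<Rightarrow> bool"
  where
    "C_class_on 0 S f \<longleftrightarrow> continuous_on S f"
  | "C_class_on (Suc k) S f \<longleftrightarrow>
       (\<forall>x\<in>S. f differentiable (at x)) \<and> (\<forall>j. C_class_on k S (partial j f))"

lemma C_class_iff: "C_class k f \<longleftrightarrow> C_class_on k UNIV f"
  by (induction k arbitrary: f) auto

lemma C_class_on_cong:
  assumes "open S"
  shows "(\<And>z. z \<in> S \<Longrightarrow> f z = g z) \<Longrightarrow> C_class_on k S f \<Longrightarrow> C_class_on k S g"
proof (induction k arbitrary: f g)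
  case 0
  then show ?case by (simp add: continuous_on_eq)
next
  case (Suc k)
  have "C_class_on k S (partial j g)" for j
    by (rule Suc.IH[of "partial j f"])
      (use Suc.prems in \<open>auto intro: partial_cong[OF assms]\<close>)
  then show ?case
    using Suc.prems differentiable_cong_open[OF assms, of _ f g] by auto
qed

lemma C_class_on_continuous: "C_class_on k S f \<Longrightarrow> open S \<Longrightarrow> continuous_on S f"
  by (cases k) (auto intro!: continuous_at_imp_continuous_on differentiable_imp_continuous_within)

lemma C_class_on_Suc_imp: "open S \<Longrightarrow> C_class_on (Suc k) S f \<Longrightarrow> C_class_on k S f"
proof (induction k arbitrary: f)
  case 0
  then show ?case using C_class_on_continuous[of "Suc 0"] by auto
qed auto

lemma C_class_on_subset: "C_class_on k S f \<Longrightarrow> T \<subseteq> S \<Longrightarrow> C_class_on k T f"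
  by (induction k arbitrary: f) (auto intro: continuous_on_subset)

lemma C_class_on_local:
  assumes "\<And>x. x \<in> S \<Longrightarrow> \<exists>T. open T \<and> x \<in> T \<and> C_class_on k T f" "open S"
  shows "C_class_on k S f"
  using assms(1)
proof (induction k arbitrary: f)
  case 0
  have "isCont f x" if "x \<in> S" for x
    using 0[OF that] continuous_on_eq_continuous_at by auto
  then show ?case by (simp add: continuous_at_imp_continuous_on)
next
  case (Suc k)
  have "C_class_on k S (partial j f)" for j
    by (rule Suc.IH) (use Suc.prems in force)
  then show ?case using Suc.prems by fastforce
qed

lemma C_class_on_SucI:
  assumes "open S" "\<And>x. x \<in> S \<Longrightarrow> (f has_derivative D x) (at x)"
    "\<And>j. C_class_on k S (\<lambda>x. D x (axis j 1))"
  shows "C_class_on (Suc k) S f"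
proof -
  have "C_class_on k S (partial j f)" for j
    by (rule C_class_on_cong[OF assms(1) _ assms(3)[of j]])
      (use assms(2) partial_eqI in metis)
  then show ?thesis using assms(2) by (auto simp: differentiable_def)
qed

lemma C_class_on_SucD:
  assumes "C_class_on (Suc k) S f" "x \<in> S"
  shows "(f has_derivative frechet_derivative f (at x)) (at x)"
  using assms by (simp add: frechet_derivative_works)

lemma C_class_on_SucD_partial:
  "C_class_on (Suc k) S f \<Longrightarrow> C_class_on k S (\<lambda>x. frechet_derivative f (at x) (axis j 1))"
  by (simp add: partial_def[abs_def])

lemma C_class_on_const: "open S \<Longrightarrow> C_class_on k S (\<lambda>x. c)"
proof (induction k arbitrary: c)
  case (Suc k)
  show ?case by (rule C_class_on_SucI[where D="\<lambda>x h. 0"]) (use Suc in auto)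
qed auto

lemma C_class_on_linear_compose:
  assumes "bounded_linear L" "open S"
  shows "C_class_on k S f \<Longrightarrow> C_class_on k S (\<lambda>x. L (f x))"
proof (induction k arbitrary: f)
  case 0
  then show ?case using bounded_linear.continuous_on[OF assms(1)] by auto
next
  case (Suc k)
  show ?case
  proof (rule C_class_on_SucI[OF assms(2)])
    show "((\<lambda>x. L (f x)) has_derivative (\<lambda>h. L (frechet_derivative f (at x) h))) (at x)" if "x \<in> S" for x
      by (rule bounded_linear.has_derivative[OF assms(1) C_class_on_SucD[OF Suc.prems that]])
    show "C_class_on k S (\<lambda>x. L (frechet_derivative f (at x) (axis j 1)))" for j
      by (rule Suc.IH[OF C_class_on_SucD_partial[OF Suc.prems]])
  qed
qed

lemma C_class_on_ident: "open S \<Longrightarrow> C_class_on k S (\<lambda>x. x)"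
proof (cases k)
  case (Suc k)
  assume "open S"
  then show ?thesis unfolding Suc
    by (intro C_class_on_SucI[where D="\<lambda>x h. h"] C_class_on_const) auto
qed auto

lemma C_class_on_add:
  assumes "open S"
  shows "C_class_on k S f \<Longrightarrow> C_class_on k S g \<Longrightarrow> C_class_on k S (\<lambda>x. f x + g x)"
proof (induction k arbitrary: f g)
  case 0
  then show ?case by (auto intro: continuous_on_add)
next
  case (Suc k)
  show ?case
  proof (rule C_class_on_SucI[OF assms])
    show "((\<lambda>x. f x + g x) has_derivative
        (\<lambda>h. frechet_derivative f (at x) h + frechet_derivative g (at x) h)) (at x)" if "x \<in> S" for x
      by (intro has_derivative_add C_class_on_SucD[OF Suc.prems(1) that] C_class_on_SucD[OF Suc.prems(2) that])
    show "C_class_on k S (\<lambda>x. frechet_derivative f (at x) (axis j 1) + frechet_derivative g (at x) (axis j 1))" for j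
      by (rule Suc.IH[OF C_class_on_SucD_partial[OF Suc.prems(1)] C_class_on_SucD_partial[OF Suc.prems(2)]])
  qed
qed

lemma C_class_on_bilinear:
  assumes "bounded_bilinear P" "open S"
  shows "C_class_on k S f \<Longrightarrow> C_class_on k S g \<Longrightarrow> C_class_on k S (\<lambda>x. P (f x) (g x))"
proof (induction k arbitrary: f g)
  case 0
  then show ?case using bounded_bilinear.continuous_on[OF assms(1)] by auto
next
  case (Suc k)
  show ?case
  proof (rule C_class_on_SucI[OF assms(2)])
    show "((\<lambda>x. P (f x) (g x)) has_derivative
        (\<lambda>h. P (f x) (frechet_derivative g (at x) h) + P (frechet_derivative f (at x) h) (g x))) (at x)"
      if "x \<in> S" for x
      by (rule bounded_bilinear.FDERIV[OF assms(1) C_class_on_SucD[OF Suc.prems(1) that] C_class_on_SucD[OF Suc.prems(2) that]])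
    show "C_class_on k S (\<lambda>x. P (f x) (frechet_derivative g (at x) (axis j 1)) +
        P (frechet_derivative f (at x) (axis j 1)) (g x))" for j
      by (intro C_class_on_add[OF assms(2)] Suc.IH C_class_on_SucD_partial[OF Suc.prems(1)]
          C_class_on_SucD_partial[OF Suc.prems(2)] C_class_on_Suc_imp[OF assms(2) Suc.prems(1)]
          C_class_on_Suc_imp[OF assms(2) Suc.prems(2)])
  qed
qed

lemmas C_class_on_minus = C_class_on_linear_compose[OF bounded_linear_minus[OF bounded_linear_ident]]
lemmas C_class_on_mult = C_class_on_bilinear[OF bounded_bilinear_mult]
lemmas C_class_on_scaleR = C_class_on_bilinear[OF bounded_bilinear_scaleR]

lemma C_class_on_sum:
  assumes "open S" "\<And>i. i \<in> I \<Longrightarrow> C_class_on k S (f i)"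
  shows "C_class_on k S (\<lambda>x. \<Sum>i\<in>I. f i x)"
  using assms(2)
  by (induction I rule: infinite_finite_induct) (auto intro!: C_class_on_const C_class_on_add assms(1))

lemma C_class_on_inverse:
  fixes f :: "real^'n \<Rightarrow> 'b::real_normed_field"
  assumes "open S" "\<And>x. x \<in> S \<Longrightarrow> f x \<noteq> 0"
  shows "C_class_on k S f \<Longrightarrow> C_class_on k S (\<lambda>x. inverse (f x))"
proof (induction k)
  case 0
  then show ?case using assms by (auto intro: continuous_on_inverse)
next
  case (Suc k)
  show ?case
  proof (rule C_class_on_SucI[OF assms(1)])
    show "((\<lambda>x. inverse (f x)) has_derivative
        (\<lambda>h. - (inverse (f x) * frechet_derivative f (at x) h * inverse (f x)))) (at x)"
      if "x \<in> S" for x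
      by (rule Deriv.has_derivative_inverse[OF assms(2)[OF that] C_class_on_SucD[OF Suc.prems that]])
    have "C_class_on k S (\<lambda>x. inverse (f x))"
      using Suc C_class_on_Suc_imp[OF assms(1)] by blast
    moreover have "C_class_on k S (\<lambda>x. frechet_derivative f (at x) (axis j 1))" for j
      by (rule C_class_on_SucD_partial[OF Suc.prems])
    ultimately show "C_class_on k S (\<lambda>x. - (inverse (f x) * frechet_derivative f (at x) (axis j 1) * inverse (f x)))" for j
      by (auto intro!: C_class_on_minus[OF assms(1)] C_class_on_mult[OF assms(1)])
  qed
qed

text \<open>This replaces formulas for higher derivatives: exponential, powers, sine and cosine, and the flat
  functions below all belong to families that are closed under differentiation.\<close>

lemma C_class_on_compose_family:
  fixes f :: "real^'n \<Rightarrow> 'b::real_normed_field" and H :: "'i \<Rightarrow> 'b \<Rightarrow> 'b"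
  assumes "open S" "\<And>x. x \<in> S \<Longrightarrow> f x \<in> T"
    and H: "\<And>i t. t \<in> T \<Longrightarrow> (H i has_field_derivative (\<Sum>l\<in>I i. c i l * H l t)) (at t)"
  shows "C_class_on k S f \<Longrightarrow> C_class_on k S (\<lambda>x. H i (f x))"
proof (induction k arbitrary: i)
  case 0
  have "continuous_on T (H i)"
    using H[of _ i] by (intro continuous_at_imp_continuous_on ballI DERIV_isCont) blast
  moreover have "continuous_on S f" "f ` S \<subseteq> T" using 0 assms(2) by auto
  ultimately have "continuous_on S (\<lambda>x. H i (f x))"
    by (rule continuous_on_compose2)
  then show ?case by simp
next
  case (Suc k)
  have S: "C_class_on k S (\<lambda>x. \<Sum>l\<in>I'. c i l * H l (f x))" for I'
    using C_class_on_sum[OF assms(1) C_class_on_mult[OF assms(1) C_class_on_const[OF assms(1)] Suc.IH[OF C_class_on_Suc_imp[OF assms(1) Suc.prems]]]] .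
  show ?case
  proof (rule C_class_on_SucI[OF assms(1)])
    show "((\<lambda>x. H i (f x)) has_derivative
        (\<lambda>h. (\<Sum>l\<in>I i. c i l * H l (f x)) * frechet_derivative f (at x) h)) (at x)"
      if "x \<in> S" for x
    proof -
      have "f x \<in> T" using assms(2)[OF that] .
      from has_derivative_compose[OF C_class_on_SucD[OF Suc.prems that]
          H[OF this, of i, unfolded has_field_derivative_def]]
      show ?thesis .
    qed
    show "C_class_on k S (\<lambda>x. (\<Sum>l\<in>I i. c i l * H l (f x)) * frechet_derivative f (at x) (axis j 1))" for j
      by (rule C_class_on_mult[OF assms(1) S C_class_on_SucD_partial[OF Suc.prems]])
  qed
qed

lemma C_class_on_diff: "open S \<Longrightarrow> C_class_on k S f \<Longrightarrow> C_class_on k S g \<Longrightarrow> C_class_on k S (\<lambda>x. f x - g x)"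
  using C_class_on_add[of S k f "\<lambda>x. - g x"] C_class_on_minus[of S k g] by simp

lemma C_class_on_exp:
  fixes f :: "real^'n \<Rightarrow> 'b::{real_normed_field,banach}"
  assumes "open S" "C_class_on k S f"
  shows "C_class_on k S (\<lambda>x. exp (f x))"
proof (rule C_class_on_compose_family[where H="\<lambda>_::unit. exp" and I="\<lambda>_. {()}" and c="\<lambda>_ _. 1" and T=UNIV, OF assms(1) _ _ assms(2)])
  show "(exp has_field_derivative (\<Sum>l\<in>{()}. 1 * exp t)) (at t)" for t :: 'b
    using DERIV_exp[of t] by simp
qed auto

lemma C_class_on_powr:
  fixes f :: "real^'n \<Rightarrow> real"
  assumes "open S" "\<And>x. x \<in> S \<Longrightarrow> f x > 0" "C_class_on k S f"
  shows "C_class_on k S (\<lambda>x. f x powr a)"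
proof (rule C_class_on_compose_family[where H="\<lambda>a t. t powr a" and I="\<lambda>a. {a-1}" and c="\<lambda>a _. a" and T="{0<..}", OF assms(1) _ _ assms(3)])
  show "((\<lambda>t. t powr a) has_real_derivative (\<Sum>l\<in>{a-1}. a * t powr l)) (at t)"
    if "t \<in> {0<..}" for a t :: real
    using has_real_derivative_powr[of t a] that by simp
qed (use assms in auto)

definition flat :: "nat \<Rightarrow> real \<Rightarrow> real"
  where "flat n t = (if t > 0 then exp (- 1 / t) / t ^ n else 0)"

lemma flat_nonneg: "flat n t \<ge> 0"
  by (simp add: flat_def)

lemma power_le_fact_exp:
  fixes x :: real
  assumes "x \<ge> 0"
  shows "x ^ k \<le> fact k * exp x"
proof -
  have "sum (\<lambda>n. x ^ n /\<^sub>R fact n) {k} \<le> (\<Sum>n. x ^ n /\<^sub>R fact n)"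
    using assms by (intro sum_le_suminf summable_exp_generic) auto
  then show ?thesis by (simp add: exp_def divide_simps mult.commute)
qed

lemma flat_bound: "flat n t \<le> fact (n + 2) * t\<^sup>2"
proof (cases "t > 0")
  case True
  have "1 / t ^ (n + 2) \<le> fact (n + 2) * exp (1 / t)"
    using power_le_fact_exp[of "1 / t" "n + 2"] True by (simp add: power_divide)
  then have "exp (- (1 / t)) / t ^ n \<le> fact (n + 2) * t\<^sup>2"
    using True by (simp add: exp_minus divide_simps power_add power2_eq_square ac_simps)
  then show ?thesis using True by (simp add: flat_def)
qed (simp add: flat_def)

lemma flat_has_derivative:
  "(flat n has_real_derivative (flat (n+2) t - n * flat (n+1) t)) (at t)"
proof -
  consider "t > 0" | "t < 0" | "t = 0" by linarith
  then show ?thesis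
  proof cases
    case 1
    have "((\<lambda>t. exp (- 1 / t) / t ^ n) has_real_derivative (flat (n+2) t - n * flat (n+1) t)) (at t)"
      using 1
      by (auto intro!: derivative_eq_intros simp: flat_def field_simps power2_eq_square)
        (cases n; simp add: field_simps)
    then show ?thesis
      by (rule has_field_derivative_transform_within_open[of _ _ _ "{0<..}"])
        (use 1 in \<open>auto simp: flat_def\<close>)
  next
    case 2
    then have "((\<lambda>t. 0) has_real_derivative (flat (n+2) t - n * flat (n+1) t)) (at t)"
      by (auto simp: flat_def)
    then show ?thesis
      by (rule has_field_derivative_transform_within_open[of _ _ _ "{..<0}"])
        (use 2 in \<open>auto simp: flat_def\<close>)
  next
    case 3
    have "((\<lambda>h. flat n h / h) \<longlongrightarrow> 0) (at 0)"
    proof (rule Lim_null_comparison)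
      show "\<forall>\<^sub>F h in at 0. norm (flat n h / h) \<le> fact (n+2) * \<bar>h\<bar>"
      proof (rule always_eventually, rule allI)
        fix h :: real
        have "flat n h / \<bar>h\<bar> \<le> fact (n+2) * \<bar>h\<bar>" 
          using flat_bound[of n h]
          by (cases "h = 0") (simp_all add: pos_divide_le_eq power2_eq_square mult.assoc)
        then show "norm (flat n h / h) \<le> fact (n+2) * \<bar>h\<bar>"
          using flat_nonneg[of n h] by (simp add: abs_div)
      qed
      show "((\<lambda>h. fact (n+2) * \<bar>h\<bar>) \<longlongrightarrow> (0::real)) (at 0)"
        by (auto intro!: tendsto_eq_intros)
    qed
    then show ?thesis
      by (simp add: 3 DERIV_def flat_def)
  qed
qed

lemma C_class_on_flat:
  fixes f :: "real^'n \<Rightarrow> real"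
  assumes "open S" "C_class_on k S f"
  shows "C_class_on k S (\<lambda>x. flat n (f x))"
proof (rule C_class_on_compose_family[where H=flat and I="\<lambda>n. {n+1,n+2}" and c="\<lambda>n l. if l = n+1 then - real n else 1" and T=UNIV, OF assms(1) _ _ assms(2)])
  show "(flat n has_real_derivative (\<Sum>l\<in>{n+1,n+2}. (if l = n+1 then - real n else 1) * flat l t)) (at t)" for n t
    using flat_has_derivative[of n t] by simp
qed auto

lemma C_class_on_cos:
  fixes f :: "real^'n \<Rightarrow> real"
  assumes "open S" "C_class_on k S f"
  shows "C_class_on k S (\<lambda>x. cos (f x))"
proof -
  let ?H = "\<lambda>b. if b then sin else cos :: real \<Rightarrow> real"
  have "C_class_on k S (\<lambda>x. ?H False (f x))"
  proof (rule C_class_on_compose_family[where H="?H" and I="\<lambda>b. {\<not> b}" and c="\<lambda>b _. if b then 1 else - 1" and T=UNIV, OF assms(1) _ _ assms(2)])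
    show "(?H b has_real_derivative (\<Sum>l\<in>{\<not> b}. (if b then 1 else - 1) * ?H l t)) (at t)" for b t
      using DERIV_sin[of t] DERIV_cos[of t] by (cases b) auto
  qed auto
  then show ?thesis by simp
qed

text \<open>A 4-periodic cut-off vanishing near the multiples of 4, which are the faces of the cells.\<close>

definition bump :: "real \<Rightarrow> real"
  where "bump t = flat 0 (2 / 5 - cos (pi / 2 * t) / 2)"

definition bump_deriv :: "real \<Rightarrow> real"
  where "bump_deriv t = flat 2 (2 / 5 - cos (pi / 2 * t) / 2) * (pi / 4 * sin (pi / 2 * t))"

lemma bump_has_derivative: "(bump has_real_derivative bump_deriv t) (at t)"
proof -
  have "((\<lambda>t. 2 / 5 - cos (pi / 2 * t) / 2) has_real_derivative (pi / 4 * sin (pi / 2 * t))) (at t)"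
    by (auto intro!: derivative_eq_intros)
  from DERIV_chain2[OF flat_has_derivative[of 0] this]
  show ?thesis unfolding bump_def[abs_def] bump_deriv_def by (simp add: numeral_2_eq_2)
qed

lemma bump_nonneg: "bump t \<ge> 0"
  by (simp add: bump_def flat_nonneg)

lemma bump_le_1: "bump t \<le> 1"
  by (simp add: bump_def flat_def)

lemma bump_deriv_bound: "\<bar>bump_deriv t\<bar> \<le> 24"
proof -
  let ?s = "2 / 5 - cos (pi / 2 * t) / 2"
  have "\<bar>2 / 5 - c / 2\<bar> \<le> 1" if "- 1 \<le> c" "c \<le> 1" for c :: real
    using that by arith
  then have "\<bar>?s\<bar> \<le> 1" using cos_ge_minus_one cos_le_one by blast
  then have "?s\<^sup>2 \<le> 1" by (simp add: abs_square_le_1)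
  then have "flat 2 ?s \<le> 24" using flat_bound[of 2 ?s] by (simp add: fact_numeral)
  moreover have "\<bar>pi / 4 * sin (pi / 2 * t)\<bar> \<le> 1 * 1"
    unfolding abs_mult using pi_less_4 by (intro mult_mono) auto
  ultimately have "flat 2 ?s * \<bar>pi / 4 * sin (pi / 2 * t)\<bar> \<le> 24 * 1"
    using flat_nonneg[of 2 ?s] by (intro mult_mono) auto
  then show ?thesis unfolding bump_deriv_def abs_mult[of "flat 2 _"] using flat_nonneg[of 2 ?s] by simp
qed

lemma C_class_on_bump: "open S \<Longrightarrow> C_class_on k S f \<Longrightarrow> C_class_on k S (\<lambda>x. bump (f x))"
  unfolding bump_def divide_inverse
  by (intro C_class_on_flat C_class_on_diff C_class_on_mult C_class_on_cos C_class_on_const)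

definition step :: "real \<Rightarrow> real"
  where "step t = flat 0 t / (flat 0 t + flat 0 (1 - t))"

lemma step_denom_pos: "flat 0 t + flat 0 (1 - t) > 0"
  by (auto simp: flat_def add_pos_pos)

lemma C_class_on_step: "open S \<Longrightarrow> C_class_on k S f \<Longrightarrow> C_class_on k S (\<lambda>x. step (f x))"
  unfolding step_def divide_inverse
  by (intro C_class_on_mult C_class_on_inverse C_class_on_add C_class_on_flat C_class_on_diff C_class_on_const
      less_imp_neq[OF step_denom_pos, symmetric])

lemma step_eq_0: "t \<le> 0 \<Longrightarrow> step t = 0" and step_eq_1: "t \<ge> 1 \<Longrightarrow> step t = 1"
  by (auto simp: step_def flat_def)

section \<open>The potential of a nonvanishing function\<close>

lemma C_class_on_vec:
  fixes f :: "real^'n \<Rightarrow> 'b::euclidean_space^'m"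
  assumes "open S" "\<And>i. C_class_on k S (\<lambda>x. f x $ i)"
  shows "C_class_on k S f"
proof -
  have f: "f x = (\<Sum>i\<in>UNIV. axis i (f x $ i))" for x
    by (simp add: vec_eq_iff axis_def if_distrib cong: if_cong)
  have "linear (axis i :: 'b \<Rightarrow> 'b^'m)" for i
    by (rule linearI) (auto simp: vec_eq_iff axis_def)
  then have "bounded_linear (axis i :: 'b \<Rightarrow> 'b^'m)" for i
    by (rule linear_conv_bounded_linear[THEN iffD1])
  then have "C_class_on k S (\<lambda>x. \<Sum>i\<in>UNIV. axis i (f x $ i))"
    by (rule C_class_on_sum[OF assms(1) C_class_on_linear_compose[OF _ assms(1) assms(2)]])
  then show ?thesis using f by simp
qed

lemma C_class_on_vec_nth: "open S \<Longrightarrow> C_class_on k S f \<Longrightarrow> C_class_on k S (\<lambda>x. f x $ i)"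
  by (rule C_class_on_linear_compose[OF bounded_linear_vec_nth])

lemma bounded_linear_mat_vec:
  fixes A :: "complex^'m^'m"
  shows "bounded_linear ((*v) A)"
  by (intro linear_conv_bounded_linear[THEN iffD1] linearI)
    (auto simp: vec_eq_iff matrix_vector_mult_def algebra_simps sum.distrib sum_distrib_left scaleR_sum_right)

lemma bounded_linear_smult:
  fixes a :: complex
  shows "bounded_linear (\<lambda>v :: complex^'m. a *s v)"
  by (intro linear_conv_bounded_linear[THEN iffD1] linearI)
    (auto simp: vec_eq_iff algebra_simps)

lemmas C_class_on_mat_vec = C_class_on_linear_compose[OF bounded_linear_mat_vec]
lemmas C_class_on_smult = C_class_on_linear_compose[OF bounded_linear_smult]
lemmas C_class_on_cnj = C_class_on_linear_compose[OF bounded_linear_cnj]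
lemmas C_class_on_of_real = C_class_on_linear_compose[OF bounded_linear_of_real]

lemma C_class_on_partial: "C_class_on (Suc k) S f \<Longrightarrow> C_class_on k S (partial j f)"
  by simp

lemma C_class_on_dirac:
  assumes "open S" "C_class_on (Suc k) S u"
  shows "C_class_on k S (dirac \<alpha> u)"
  unfolding dirac_def[abs_def]
  by (intro C_class_on_smult C_class_on_sum C_class_on_mat_vec C_class_on_partial assms)

lemma C_class_on_inner_self: "C_class_on k UNIV (\<lambda>x :: real^'n. x \<bullet> x)"
  by (intro C_class_on_bilinear[OF bounded_bilinear_inner] C_class_on_ident) auto

lemma smooth_iff: "smooth f \<longleftrightarrow> (\<forall>k. C_class_on k UNIV f)"
  by (simp add: smooth_def C_class_iff)

lemma norm_rank_one:
  fixes d c :: "complex^'m"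
  shows "norm (\<chi> i j. d $ i * c $ j) = norm d * norm c"
proof -
  have "norm (\<chi> j. d $ i * c $ j) = norm (d $ i) * norm c" for i
    by (simp add: norm_vec_def L2_set_right_distrib norm_mult)
  then show ?thesis
    by (simp add: norm_vec_def[of "\<chi> i j. d $ i * c $ j"] L2_set_left_distrib[symmetric])
      (simp add: norm_vec_def L2_set_left_distrib)
qed

lemma norm_cnj_mult_vec:
  fixes v :: "complex^'m"
  shows "norm (\<chi> j. cnj (v $ j) * c) = norm v * norm c"
  by (simp add: norm_vec_def norm_mult L2_set_left_distrib)

text \<open>The rank-one matrix \<open>D u \<otimes> u\<^sup>* / |u|\<^sup>2\<close> solves the equation. The term with the cut-off
  \<open>T\<close> annihilates \<open>u\<close>; it only serves to make \<open>V\<close> visibly nonzero.\<close>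

lemma potential_exists:
  fixes u :: "real^'n \<Rightarrow> complex^'m" and \<alpha> :: "(complex^'m^'m)^'n"
  assumes card: "CARD('m) \<ge> 2" and u: "smooth u" "\<And>x. u x \<noteq> 0"
    and near: "\<And>x. norm x < 2 \<Longrightarrow> dirac \<alpha> u x = 0"
    and far: "\<And>x. norm x \<ge> R \<Longrightarrow> norm (dirac \<alpha> u x) \<le> K * norm x powr (- \<epsilon>) * norm (u x)"
    and R: "R \<ge> 3"
  shows "\<exists>V C. smooth V \<and> (\<exists>x. V x \<noteq> 0) \<and> C > 0 \<and> (\<forall>x. dirac \<alpha> u x = V x *v u x \<and>
    (norm x < 2 \<longrightarrow> V x = 0) \<and> norm (V x) \<le> C * norm x powr (- \<epsilon>))"
proof -
  define N :: "real^'n \<Rightarrow> complex" where "N x = (\<Sum>k\<in>UNIV. u x $ k * cnj (u x $ k))" for x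
  define T :: "real^'n \<Rightarrow> complex"
    where "T x = of_real (flat 0 (x \<bullet> x - 4) * flat 0 (9 - x \<bullet> x))" for x
  define V :: "real^'n \<Rightarrow> complex^'m^'m" where "V x = (\<chi> i j.
      dirac \<alpha> u x $ i * cnj (u x $ j) * inverse (N x) +
      T x * ((if i = j then N x else 0) - u x $ i * cnj (u x $ j)))" for x
  have N: "N x = of_real ((norm (u x))\<^sup>2)" for x
    by (simp add: N_def norm_vec_def L2_set_def sum_nonneg complex_norm_square del: of_real_power)
  then have N0: "N x \<noteq> 0" for x using u(2) by simp
  have Cu: "C_class_on k UNIV (\<lambda>x. u x $ i)" for k i
    using u(1) by (intro C_class_on_vec_nth) (auto simp: smooth_iff)
  have Ccu: "C_class_on k UNIV (\<lambda>x. cnj (u x $ i))" for k i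
    by (intro C_class_on_cnj Cu) auto
  have Cd: "C_class_on k UNIV (\<lambda>x. dirac \<alpha> u x $ i)" for k i
    using u(1) by (intro C_class_on_vec_nth C_class_on_dirac) (auto simp: smooth_iff simp del: C_class_on.simps)
  have CN: "C_class_on k UNIV N" for k
    unfolding N_def[abs_def] by (intro C_class_on_sum C_class_on_mult Cu Ccu) auto
  have CT: "C_class_on k UNIV T" for k
    unfolding T_def[abs_def]
    by (intro C_class_on_of_real C_class_on_mult C_class_on_flat C_class_on_diff
        C_class_on_inner_self C_class_on_const) auto
  have CV: "C_class_on k UNIV V" for k
  proof (intro C_class_on_vec)
    fix i j :: 'm
    have I: "C_class_on k UNIV (\<lambda>x. if i = j then N x else 0)"
      using CN[of k] C_class_on_const[OF open_UNIV, of k "0::complex"] by (cases "i = j") simp_all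
    show "C_class_on k UNIV (\<lambda>x. V x $ i $ j)"
      unfolding V_def vec_lambda_beta
      by (intro C_class_on_add C_class_on_mult C_class_on_diff Cd Ccu Cu CT I C_class_on_inverse[OF _ _ CN] N0) auto
  qed auto
  have eq: "dirac \<alpha> u x = V x *v u x" for x
  proof (subst vec_eq_iff, rule allI)
    fix i
    have "(V x *v u x) $ i = (\<Sum>j\<in>UNIV. dirac \<alpha> u x $ i * inverse (N x) * (u x $ j * cnj (u x $ j)) +
        T x * ((if i = j then N x * u x $ j else 0) - u x $ i * (u x $ j * cnj (u x $ j))))"
      unfolding matrix_vector_mult_def V_def
      by (simp, intro sum.cong) (auto simp: algebra_simps)
    also have "\<dots> = dirac \<alpha> u x $ i * inverse (N x) * N x + T x * (N x * u x $ i - u x $ i * N x)"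
      by (simp add: sum.distrib sum_subtractf flip: sum_distrib_left N_def)
    also have "\<dots> = dirac \<alpha> u x $ i" using N0 by simp
    finally show "dirac \<alpha> u x $ i = (V x *v u x) $ i" by simp
  qed
  have V2: "V x = 0" if "norm x < 2" for x
  proof -
    have "(norm x)\<^sup>2 \<le> 2\<^sup>2" using that by (intro power_mono) auto
    then have "T x = 0" by (simp add: T_def flat_def power2_norm_eq_inner)
    then show ?thesis by (simp add: V_def near[OF that] vec_eq_iff)
  qed
  have Vfar: "norm (V x) \<le> K * norm x powr (- \<epsilon>)" if "norm x \<ge> R" for x
  proof -
    have "3\<^sup>2 \<le> (norm x)\<^sup>2" using that R by (intro power_mono) auto
    then have "T x = 0" by (simp add: T_def flat_def power2_norm_eq_inner)
    then have "V x = (\<chi> i j. dirac \<alpha> u x $ i * (\<chi> j. cnj (u x $ j) * inverse (N x)) $ j)"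
      by (simp add: V_def vec_eq_iff)
    then have "norm (V x) = norm (dirac \<alpha> u x) * norm (\<chi> j. cnj (u x $ j) * inverse (N x))"
      using norm_rank_one by metis
    also have "norm (\<chi> j. cnj (u x $ j) * inverse (N x)) = norm (u x) * inverse ((norm (u x))\<^sup>2)"
      by (simp add: norm_cnj_mult_vec N norm_inverse norm_power)
    also have "norm (dirac \<alpha> u x) * \<dots> \<le> (K * norm x powr (- \<epsilon>) * norm (u x)) * \<dots>"
      by (intro mult_right_mono far[OF that]) auto
    also have "\<dots> = K * norm x powr (- \<epsilon>)"
      using u(2)[of x] by (simp add: power2_eq_square field_simps)
    finally show ?thesis .
  qed
  have "compact {x :: real^'n. 2 \<le> norm x \<and> norm x \<le> R}"
  proof -
    have "{x :: real^'n. 2 \<le> norm x \<and> norm x \<le> R} = cball 0 R \<inter> - ball 0 2" by auto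
    then show ?thesis by (auto intro!: compact_Int_closed)
  qed
  moreover have "continuous_on {x. 2 \<le> norm x \<and> norm x \<le> R} (\<lambda>x. norm (V x) * norm x powr \<epsilon>)"
    using CV[of 0] by (intro continuous_intros) (auto intro: continuous_on_subset)
  ultimately have "bounded ((\<lambda>x. norm (V x) * norm x powr \<epsilon>) ` {x. 2 \<le> norm x \<and> norm x \<le> R})"
    by (intro compact_imp_bounded compact_continuous_image)
  then obtain B where B: "\<And>x. 2 \<le> norm x \<Longrightarrow> norm x \<le> R \<Longrightarrow> norm (V x) * norm x powr \<epsilon> \<le> B"
    unfolding bounded_real by fastforce
  define C where "C = max 1 (max K B)"
  have bound: "norm (V x) \<le> C * norm x powr (- \<epsilon>)" for x
  proof -
    consider "norm x < 2" | "2 \<le> norm x" "norm x \<le> R" | "norm x \<ge> R" by linarith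
    then show ?thesis
    proof cases
      case 1
      then show ?thesis using V2 by (simp add: C_def)
    next
      case 2
      then have "norm x powr \<epsilon> > 0" by auto
      then have "norm (V x) \<le> B * norm x powr (- \<epsilon>)"
        using B[OF 2] by (simp add: powr_minus field_simps)
      also have "\<dots> \<le> C * norm x powr (- \<epsilon>)" by (intro mult_right_mono) (auto simp: C_def)
      finally show ?thesis .
    next
      case 3
      have "K * norm x powr (- \<epsilon>) \<le> C * norm x powr (- \<epsilon>)"
        by (intro mult_right_mono) (auto simp: C_def)
      then show ?thesis using Vfar[OF 3] by linarith
    qed
  qed
  have "\<exists>x. V x \<noteq> 0"
  proof -
    obtain k :: 'n where True by auto
    define x :: "real^'n" where "x = axis k (5/2)"
    have "x \<bullet> x = 25/4" by (simp add: x_def inner_axis_axis)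
    then have T: "T x \<noteq> 0" by (simp add: T_def flat_def)
    obtain i where i: "u x $ i \<noteq> 0" using u(2)[of x] by (auto simp: vec_eq_iff)
    have "\<exists>j. j \<noteq> i"
    proof (rule ccontr)
      assume "\<nexists>j. j \<noteq> i"
      then have "(UNIV :: 'm set) = {i}" by auto
      from arg_cong[OF this, of card] show False using card by simp
    qed
    then obtain j where j: "j \<noteq> i" by auto
    have "V x $ j $ i * cnj (u x $ j) - V x $ j $ j * cnj (u x $ i) = - T x * N x * cnj (u x $ i)"
      using j by (simp add: V_def algebra_simps)
    also have "\<dots> \<noteq> 0" using T N0 i by simp
    finally have "V x \<noteq> 0" by (intro notI) simp
    then show ?thesis by blast
  qed
  then show ?thesis
    using CV eq V2 bound by (intro exI[of _ V] exI[of _ C]) (auto simp: smooth_iff C_def)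
qed

section \<open>Patching local solutions\<close>

definition centred :: "('d \<Rightarrow> 'a \<Rightarrow> real) \<Rightarrow> nat \<Rightarrow> 'a \<Rightarrow> bool"
  where "centred y c x \<longleftrightarrow> (\<forall>i. cos (pi / 2 * (y i x - real c)) \<le> 4 / 5)"

definition cell :: "('d \<Rightarrow> 'a \<Rightarrow> real) \<Rightarrow> nat \<Rightarrow> 'a \<Rightarrow> 'd \<Rightarrow> int"
  where "cell y c x i = \<lfloor>(y i x - real c) / 4\<rfloor>"

definition weight :: "('d::finite \<Rightarrow> 'a \<Rightarrow> real) \<Rightarrow> nat \<Rightarrow> 'a \<Rightarrow> real"
  where "weight y c x = (\<Prod>i\<in>UNIV. bump (y i x - real c))"

definition patch ::
    "('d::finite \<Rightarrow> 'a \<Rightarrow> real) \<Rightarrow> (nat \<Rightarrow> ('d \<Rightarrow> int) \<Rightarrow> 'a \<Rightarrow> 'b::real_normed_vector) \<Rightarrow> nat \<Rightarrow> 'a \<Rightarrow> 'b"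
  where "patch y W c x = weight y c x *\<^sub>R W c (cell y c x) x"

lemma weight_nonneg: "weight y c x \<ge> 0"
  by (simp add: weight_def prod_nonneg bump_nonneg)

lemma weight_le_1: "weight y c x \<le> 1"
  unfolding weight_def by (intro prod_le_1) (simp add: bump_nonneg bump_le_1)

lemma weight_eq_0: "\<not> centred y c x \<Longrightarrow> weight y c x = 0"
proof -
  assume "\<not> centred y c x"
  then obtain i where "cos (pi / 2 * (y i x - real c)) > 4 / 5"
    by (auto simp: centred_def not_le)
  then have "bump (y i x - real c) = 0" by (simp add: bump_def flat_def)
  then show ?thesis unfolding weight_def by (intro prod_zero) auto
qed

lemma patch_eq_0: "\<not> centred y c x \<Longrightarrow> patch y W c x = 0"
  by (simp add: patch_def weight_eq_0)

lemma not_centred_nbhd: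
  fixes y :: "'d::finite \<Rightarrow> 'a::t2_space \<Rightarrow> real"
  assumes "\<And>i. continuous_on UNIV (y i)" "\<not> centred y c x"
  obtains S where "open S" "x \<in> S" "\<And>z. z \<in> S \<Longrightarrow> patch y W c z = 0"
proof -
  obtain i where i: "cos (pi / 2 * (y i x - real c)) > 4 / 5"
    using assms(2) by (auto simp: centred_def not_le)
  let ?S = "{z. cos (pi / 2 * (y i z - real c)) > 4 / 5}"
  have "open ?S"
    by (intro open_Collect_less continuous_on_cos continuous_on_mult continuous_on_diff
        continuous_on_const assms(1))
  moreover have "patch y W c z = 0" if "z \<in> ?S" for z
    using that by (intro patch_eq_0) (auto simp: centred_def not_le intro!: exI[of _ i])
  ultimately show thesis using i by (intro that[of ?S]) auto
qed

lemma cell_nbhd: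
  fixes y :: "'d::finite \<Rightarrow> 'a::t2_space \<Rightarrow> real"
  assumes "\<And>i. continuous_on UNIV (y i)" "centred y c x"
  obtains S where "open S" "x \<in> S" "\<And>z. z \<in> S \<Longrightarrow> cell y c z = cell y c x"
proof -
  let ?J = "cell y c x"
  let ?S = "\<Inter>i. {z. of_int (?J i) < (y i z - real c) / 4} \<inter> {z. (y i z - real c) / 4 < of_int (?J i) + 1}"
  have "open ?S"
    by (intro open_INT ballI open_Int open_Collect_less continuous_on_divide continuous_on_diff
        continuous_on_const assms(1)) auto
  moreover have "x \<in> ?S"
  proof (rule INT_I)
    fix i
    have "of_int (?J i) \<noteq> (y i x - real c) / 4"
    proof
      assume "of_int (?J i) = (y i x - real c) / 4"
      then have "pi / 2 * (y i x - real c) = of_int (?J i) * 2 * pi" by simp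
      then have "cos (pi / 2 * (y i x - real c)) = 1"
        unfolding cos_one_2pi_int by blast
      moreover have "cos (pi / 2 * (y i x - real c)) \<le> 4 / 5"
        using assms(2) by (simp only: centred_def)
      ultimately show False by linarith
    qed
    moreover have "of_int (?J i) \<le> (y i x - real c) / 4" "(y i x - real c) / 4 < of_int (?J i) + 1"
      unfolding cell_def by (rule of_int_floor_le, rule floor_correct[THEN conjunct2, simplified of_int_add of_int_1])
    ultimately show "x \<in> {z. of_int (?J i) < (y i z - real c) / 4} \<inter> {z. (y i z - real c) / 4 < of_int (?J i) + 1}"
      by (simp only: Int_iff mem_Collect_eq less_le) blast
  qed
  moreover have "cell y c z = cell y c x" if "z \<in> ?S" for z
  proof
    fix i
    have "of_int (?J i) < (y i z - real c) / 4" "(y i z - real c) / 4 < of_int (?J i) + 1"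
      using that by auto
    then show "cell y c z i = cell y c x i"
      by (subst cell_def) (intro floor_unique; simp)
  qed
  ultimately show thesis by (rule that)
qed

lemma C_class_on_prod:
  fixes f :: "'i \<Rightarrow> real^'n \<Rightarrow> real"
  assumes "open S" "\<And>i. i \<in> I \<Longrightarrow> C_class_on k S (f i)"
  shows "C_class_on k S (\<lambda>x. \<Prod>i\<in>I. f i x)"
  using assms(2)
  by (induction I rule: infinite_finite_induct) (auto intro!: C_class_on_const C_class_on_mult assms(1))

lemma C_class_on_weight:
  assumes "\<And>i. C_class_on k UNIV (y i)"
  shows "C_class_on k UNIV (weight y c)"
  unfolding weight_def[abs_def]
  by (intro C_class_on_prod C_class_on_bump C_class_on_diff C_class_on_const assms) auto

lemma partial_mult:
  fixes f g :: "real^'n \<Rightarrow> real"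
  assumes "f differentiable (at x)" "g differentiable (at x)"
  shows "partial j (\<lambda>x. f x * g x) x = f x * partial j g x + partial j f x * g x"
  using has_derivative_mult[of f _ x UNIV g] assms unfolding frechet_derivative_works
  by (subst partial_eqI) (auto simp: partial_def)

lemma differentiable_prod:
  fixes f :: "'i \<Rightarrow> real^'n \<Rightarrow> real"
  shows "finite I \<Longrightarrow> (\<And>i. i \<in> I \<Longrightarrow> f i differentiable (at x)) \<Longrightarrow> (\<lambda>x. \<Prod>i\<in>I. f i x) differentiable (at x)"
  by (induction I rule: finite_induct) auto

lemma partial_prod_bound:
  fixes f :: "'i \<Rightarrow> real^'n \<Rightarrow> real"
  assumes "finite I" "\<And>i. i \<in> I \<Longrightarrow> f i differentiable (at x)" "\<And>i. i \<in> I \<Longrightarrow> \<bar>f i x\<bar> \<le> 1"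
  shows "\<bar>partial j (\<lambda>x. \<Prod>i\<in>I. f i x) x\<bar> \<le> (\<Sum>i\<in>I. \<bar>partial j (f i) x\<bar>)"
  using assms
proof (induction I rule: finite_induct)
  case empty
  have "partial j (\<lambda>x. 1 :: real) x = 0" by (subst partial_eqI[OF has_derivative_const]) simp
  then show ?case by simp
next
  case (insert i I)
  let ?g = "\<lambda>x. \<Prod>i\<in>I. f i x"
  have d: "?g differentiable (at x)"
    using insert.prems(1) insert.hyps(1) by (intro differentiable_prod) auto
  have "\<bar>?g x\<bar> \<le> 1"
    unfolding abs_prod using insert.prems(2) by (intro prod_le_1) auto
  then have "\<bar>partial j (f i) x * ?g x\<bar> \<le> \<bar>partial j (f i) x\<bar>"
    using mult_left_mono[of "\<bar>?g x\<bar>" 1 "\<bar>partial j (f i) x\<bar>"] by (simp add: abs_mult)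
  moreover have "\<bar>f i x * partial j ?g x\<bar> \<le> \<bar>partial j ?g x\<bar>"
    using mult_right_mono[of "\<bar>f i x\<bar>" 1 "\<bar>partial j ?g x\<bar>"] insert.prems(2)[of i] by (simp add: abs_mult)
  moreover have "\<bar>partial j ?g x\<bar> \<le> (\<Sum>i\<in>I. \<bar>partial j (f i) x\<bar>)"
    using insert by simp
  ultimately show ?case
    using insert.hyps by (simp add: partial_mult[OF insert.prems(1)[of i] d])
qed

lemma partial_bump:
  assumes "f differentiable (at x)"
  shows "partial j (\<lambda>x. bump (f x - c)) x = bump_deriv (f x - c) * partial j f x"
    and "(\<lambda>x. bump (f x - c)) differentiable (at x)"
proof -
  have "((\<lambda>x. f x - c) has_derivative frechet_derivative f (at x)) (at x)"
    using assms unfolding frechet_derivative_works by (auto intro!: derivative_eq_intros)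
  from has_derivative_compose[OF this bump_has_derivative[unfolded has_field_derivative_def]]
  show "partial j (\<lambda>x. bump (f x - c)) x = bump_deriv (f x - c) * partial j f x"
    "(\<lambda>x. bump (f x - c)) differentiable (at x)"
    by (auto simp: partial_eqI partial_def[of j f] differentiable_def)
qed

lemma partial_weight_bound:
  fixes y :: "'d::finite \<Rightarrow> real^'n \<Rightarrow> real" and K :: real
  assumes "\<And>i. y i differentiable (at x)" "\<And>i. \<bar>partial j (y i) x\<bar> \<le> K"
  shows "\<bar>partial j (weight y c) x\<bar> \<le> CARD('d) * 24 * K"
proof -
  have "\<bar>partial j (weight y c) x\<bar> \<le> (\<Sum>i\<in>UNIV. \<bar>partial j (\<lambda>x. bump (y i x - real c)) x\<bar>)"
    unfolding weight_def[abs_def]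
    by (intro partial_prod_bound) (auto intro!: partial_bump(2) assms simp: bump_nonneg bump_le_1)
  also have "\<dots> \<le> (\<Sum>i\<in>(UNIV :: 'd set). 24 * K)"
    unfolding partial_bump(1)[OF assms(1)] abs_mult
    by (intro sum_mono mult_mono bump_deriv_bound assms(2)) auto
  finally show ?thesis by simp
qed

lemma partial_eq_0:
  assumes "open S" "x \<in> S" "\<And>z. z \<in> S \<Longrightarrow> f z = c"
  shows "partial j f x = 0"
  using partial_cong[OF assms] partial_eqI[OF has_derivative_const, of j c x] by simp

lemma dirac_cong:
  assumes "open S" "x \<in> S" "\<And>z. z \<in> S \<Longrightarrow> f z = g z"
  shows "dirac \<alpha> f x = dirac \<alpha> g x"
  using partial_cong[OF assms] by (simp add: dirac_def)

lemma dirac_sum: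
  assumes "finite I" "\<And>c. c \<in> I \<Longrightarrow> f c differentiable (at x)"
  shows "dirac \<alpha> (\<lambda>x. \<Sum>c\<in>I. f c x) x = (\<Sum>c\<in>I. dirac \<alpha> (f c) x)"
proof -
  have "((\<lambda>x. \<Sum>c\<in>I. f c x) has_derivative (\<lambda>h. \<Sum>c\<in>I. frechet_derivative (f c) (at x) h)) (at x)"
    using assms(2) unfolding frechet_derivative_works by (intro has_derivative_sum)
  then have "partial j (\<lambda>x. \<Sum>c\<in>I. f c x) x = (\<Sum>c\<in>I. partial j (f c) x)" for j
    by (simp add: partial_eqI partial_def[of j "f _"])
  then have "dirac \<alpha> (\<lambda>x. \<Sum>c\<in>I. f c x) x = (- \<i>) *s (\<Sum>c\<in>I. \<Sum>j\<in>UNIV. \<alpha> $ j *v partial j (f c) x)"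
    unfolding dirac_def
    by (simp add: linear_sum[OF bounded_linear.linear[OF bounded_linear_mat_vec]] sum.swap[of _ I])
  also have "\<dots> = (\<Sum>c\<in>I. dirac \<alpha> (f c) x)"
    unfolding dirac_def
    using linear_sum[OF bounded_linear.linear[OF bounded_linear_smult[of "- \<i>"]]] by blast
  finally show ?thesis .
qed

lemma dirac_scaleR_bound:
  fixes w :: "real^'n \<Rightarrow> complex^'m"
  shows "\<exists>M>0. \<forall>b w x Q. b differentiable (at x) \<longrightarrow> w differentiable (at x) \<longrightarrow> dirac \<alpha> w x = 0 \<longrightarrow>
    (\<forall>j. \<bar>partial j b x\<bar> \<le> Q) \<longrightarrow>
    norm (dirac (\<alpha> :: (complex^'m^'m)^'n) (\<lambda>x. b x *\<^sub>R w x) x) \<le> M * Q * norm (w x)"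
proof -
  have "\<forall>j. \<exists>B>0. \<forall>v. norm (\<alpha> $ j *v v) \<le> norm v * B"
    using bounded_linear.pos_bounded[OF bounded_linear_mat_vec] by blast
  then obtain B where B: "\<And>j. B j > 0" "\<And>j v. norm (\<alpha> $ j *v v) \<le> norm v * B j"
    by metis
  show ?thesis
  proof (intro exI[of _ "sum B UNIV"] conjI allI impI)
    show "sum B UNIV > 0" using B(1) by (intro sum_pos) auto
    fix b :: "real^'n \<Rightarrow> real" and w :: "real^'n \<Rightarrow> complex^'m" and x Q
    assume b: "b differentiable (at x)" and w: "w differentiable (at x)" and 0: "dirac \<alpha> w x = 0"
      and Q: "\<forall>j. \<bar>partial j b x\<bar> \<le> Q"
    have p: "partial j (\<lambda>x. b x *\<^sub>R w x) x = b x *\<^sub>R partial j w x + partial j b x *\<^sub>R w x" for j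
      using has_derivative_scaleR[of b _ x UNIV w] b w unfolding frechet_derivative_works
      by (subst partial_eqI) (auto simp: partial_def)
    have lin: "\<alpha> $ j *v (r *\<^sub>R v) = r *\<^sub>R (\<alpha> $ j *v v)" for j r v
      by (rule linear_scale[OF bounded_linear.linear[OF bounded_linear_mat_vec]])
    have "dirac \<alpha> (\<lambda>x. b x *\<^sub>R w x) x = (- \<i>) *s (b x *\<^sub>R (\<Sum>j\<in>UNIV. \<alpha> $ j *v partial j w x) +
       (\<Sum>j\<in>UNIV. partial j b x *\<^sub>R (\<alpha> $ j *v w x)))"
      by (simp add: dirac_def p matrix_vector_right_distrib lin sum.distrib scaleR_sum_right)
    also have "(\<Sum>j\<in>UNIV. \<alpha> $ j *v partial j w x) = 0"
      using 0 by (simp add: dirac_def)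
    finally have "dirac \<alpha> (\<lambda>x. b x *\<^sub>R w x) x = (- \<i>) *s (\<Sum>j\<in>UNIV. partial j b x *\<^sub>R (\<alpha> $ j *v w x))"
      by simp
    then have "norm (dirac \<alpha> (\<lambda>x. b x *\<^sub>R w x) x) = norm (\<Sum>j\<in>UNIV. partial j b x *\<^sub>R (\<alpha> $ j *v w x))"
      by (simp add: norm_vec_def norm_mult)
    also have "\<dots> \<le> (\<Sum>j\<in>UNIV. Q * (norm (w x) * B j))"
    proof (rule sum_norm_le)
      fix j
      have "Q \<ge> 0" using Q abs_ge_zero order.trans by blast
      then show "norm (partial j b x *\<^sub>R (\<alpha> $ j *v w x)) \<le> Q * (norm (w x) * B j)"
        unfolding norm_scaleR using Q B(2) by (intro mult_mono) auto
    qed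
    also have "\<dots> = sum B UNIV * Q * norm (w x)"
      by (simp add: sum_distrib_left sum_distrib_right ac_simps)
    finally show "norm (dirac \<alpha> (\<lambda>x. b x *\<^sub>R w x) x) \<le> sum B UNIV * Q * norm (w x)" .
  qed
qed

lemma C_class_on_patch:
  fixes y :: "'d::finite \<Rightarrow> real^'n \<Rightarrow> real"
    and W :: "nat \<Rightarrow> ('d \<Rightarrow> int) \<Rightarrow> real^'n \<Rightarrow> 'b::real_normed_vector"
  assumes y: "\<And>k i. C_class_on k UNIV (y i)"
    and W: "\<And>x. centred y c x \<Longrightarrow> \<exists>S. open S \<and> x \<in> S \<and> (\<forall>k. C_class_on k S (W c (cell y c x)))"
  shows "C_class_on k UNIV (patch y W c)"
proof (rule C_class_on_local)
  have cont: "continuous_on UNIV (y i)" for i using y[of 0 i] by simp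
  fix x
  show "\<exists>T. open T \<and> x \<in> T \<and> C_class_on k T (patch y W c)"
  proof (cases "centred y c x")
    case False
    obtain S where S: "open S" "x \<in> S" "\<And>z. z \<in> S \<Longrightarrow> patch y W c z = 0"
      using not_centred_nbhd[OF cont False] by metis
    have "C_class_on k S (patch y W c)"
      by (rule C_class_on_cong[OF S(1) _ C_class_on_const[OF S(1), of k 0]]) (simp add: S(3))
    then show ?thesis using S by blast
  next
    case True
    obtain S where S: "open S" "x \<in> S" "\<And>z. z \<in> S \<Longrightarrow> cell y c z = cell y c x"
      using cell_nbhd[OF cont True] by metis
    obtain S' where S': "open S'" "x \<in> S'" "\<And>k. C_class_on k S' (W c (cell y c x))"
      using W[OF True] by blast
    have o: "open (S \<inter> S')" using S(1) S'(1) by auto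
    have "C_class_on k (S \<inter> S') (weight y c)"
      by (rule C_class_on_subset[OF C_class_on_weight[OF y] subset_UNIV])
    moreover have "C_class_on k (S \<inter> S') (W c (cell y c x))"
      by (rule C_class_on_subset[OF S'(3) Int_lower2])
    ultimately have "C_class_on k (S \<inter> S') (\<lambda>z. weight y c z *\<^sub>R W c (cell y c x) z)"
      by (rule C_class_on_scaleR[OF o])
    then have "C_class_on k (S \<inter> S') (patch y W c)"
      by (rule C_class_on_cong[OF o, rotated]) (simp add: patch_def S(3))
    then show ?thesis using o S(2) S'(2) by blast
  qed
qed auto

lemma dirac_patch_bound:
  fixes \<alpha> :: "(complex^'m^'m)^'n"
  obtains M where "M > 0"
    "\<And>(y :: 'd::finite \<Rightarrow> real^'n \<Rightarrow> real) (W :: nat \<Rightarrow> ('d \<Rightarrow> int) \<Rightarrow> real^'n \<Rightarrow> complex^'m) c x Q B.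
      (\<And>k i. C_class_on k UNIV (y i)) \<Longrightarrow>
      (\<And>i j. \<bar>partial j (y i) x\<bar> \<le> Q) \<Longrightarrow>
      (centred y c x \<Longrightarrow> W c (cell y c x) differentiable (at x)) \<Longrightarrow>
      (centred y c x \<Longrightarrow> dirac \<alpha> (W c (cell y c x)) x = 0) \<Longrightarrow>
      (centred y c x \<Longrightarrow> norm (W c (cell y c x) x) \<le> B) \<Longrightarrow> B \<ge> 0 \<Longrightarrow>
      norm (dirac \<alpha> (patch y W c) x) \<le> M * Q * B"
proof -
  obtain M0 where M0: "M0 > 0" and bound: "\<And>b w x Q. b differentiable (at x) \<Longrightarrow> w differentiable (at x) \<Longrightarrow>
      dirac \<alpha> w x = 0 \<Longrightarrow> (\<forall>j. \<bar>partial j b x\<bar> \<le> Q) \<Longrightarrow>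
      norm (dirac \<alpha> (\<lambda>x. b x *\<^sub>R w x) x) \<le> M0 * Q * norm (w x)"
    using dirac_scaleR_bound[of \<alpha>] by blast
  show thesis
  proof (rule that[of "M0 * (CARD('d) * 24)"])
    show "M0 * (CARD('d) * 24) > 0" using M0 by simp
    fix y :: "'d \<Rightarrow> real^'n \<Rightarrow> real" and W :: "nat \<Rightarrow> ('d \<Rightarrow> int) \<Rightarrow> real^'n \<Rightarrow> complex^'m" and c x Q B
    assume y: "\<And>k i. C_class_on k UNIV (y i)" and Q: "\<And>i j. \<bar>partial j (y i) x\<bar> \<le> Q"
      and W: "centred y c x \<Longrightarrow> W c (cell y c x) differentiable (at x)"
        "centred y c x \<Longrightarrow> dirac \<alpha> (W c (cell y c x)) x = 0"
        "centred y c x \<Longrightarrow> norm (W c (cell y c x) x) \<le> B"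
      and B: "B \<ge> 0"
    have cont: "continuous_on UNIV (y i)" for i using y[of 0 i] by simp
    have diff: "y i differentiable (at x)" for i using y[of "Suc 0" i] by simp
    have Q0: "Q \<ge> 0" using Q abs_ge_zero order.trans by blast
    show "norm (dirac \<alpha> (patch y W c) x) \<le> M0 * (CARD('d) * 24) * Q * B"
    proof (cases "centred y c x")
      case False
      obtain S where S: "open S" "x \<in> S" "\<And>z. z \<in> S \<Longrightarrow> patch y W c z = 0"
        using not_centred_nbhd[OF cont False] by metis
      have "dirac \<alpha> (patch y W c) x = 0"
        using partial_eq_0[OF S] by (simp add: dirac_def)
      then show ?thesis using M0 Q0 B by simp
    next
      case True
      obtain S where S: "open S" "x \<in> S" "\<And>z. z \<in> S \<Longrightarrow> cell y c z = cell y c x"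
        using cell_nbhd[OF cont True] by metis
      have "dirac \<alpha> (patch y W c) x = dirac \<alpha> (\<lambda>z. weight y c z *\<^sub>R W c (cell y c x) z) x"
        by (rule dirac_cong[OF S(1,2)]) (simp add: patch_def S(3))
      also have "norm \<dots> \<le> M0 * (CARD('d) * 24 * Q) * norm (W c (cell y c x) x)"
        using C_class_on_weight[of "Suc 0" y c] y
        by (intro bound W True allI partial_weight_bound diff Q) auto
      also have "\<dots> \<le> M0 * (CARD('d) * 24 * Q) * B"
        using M0 Q0 W(3)[OF True] by (intro mult_left_mono) auto
      finally show ?thesis by (simp add: ac_simps)
    qed
  qed
qed

theorem patchwork:
  fixes y :: "'d::finite \<Rightarrow> real^'n \<Rightarrow> real"
    and W :: "nat \<Rightarrow> ('d \<Rightarrow> int) \<Rightarrow> real^'n \<Rightarrow> complex^'m"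
    and \<alpha> :: "(complex^'m^'m)^'n" and \<epsilon> K R k :: real
  assumes fin: "finite I" and card: "CARD('m) \<ge> 2" and R: "R \<ge> 3" and k: "k > 0" and eps: "\<epsilon> < 1"
    and y: "\<And>k i. C_class_on k UNIV (y i)"
    and y0: "\<And>i x. norm x < 2 \<Longrightarrow> y i x = 0"
    and y1: "\<And>i j x. norm x \<ge> R \<Longrightarrow> \<bar>partial j (y i) x\<bar> \<le> K * norm x powr (- \<epsilon>)"
    and W: "\<And>c x. c \<in> I \<Longrightarrow> centred y c x \<Longrightarrow>
      \<exists>S. open S \<and> x \<in> S \<and> (\<forall>k. C_class_on k S (W c (cell y c x)))"
    and dW: "\<And>c x. c \<in> I \<Longrightarrow> centred y c x \<Longrightarrow> dirac \<alpha> (W c (cell y c x)) x = 0"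
    and up: "\<And>c x. c \<in> I \<Longrightarrow> centred y c x \<Longrightarrow> norm x \<ge> R \<Longrightarrow>
      norm (W c (cell y c x) x) \<le> K * exp (- (norm x powr (2 - 2 * \<epsilon>)))"
    and low: "\<And>x. norm x \<ge> R \<Longrightarrow>
      norm (\<Sum>c\<in>I. patch y W c x) \<ge> k * exp (- (norm x powr (2 - 2 * \<epsilon>)))"
    and nz: "\<And>x. (\<Sum>c\<in>I. patch y W c x) \<noteq> 0"
  shows "\<exists>u V. smooth u \<and> smooth V \<and> (\<exists>x. u x \<noteq> 0) \<and> (\<exists>x. V x \<noteq> 0) \<and>
    (\<exists>C1>0. \<exists>C2>0. \<exists>C3>0. \<forall>x. dirac \<alpha> u x = V x *v u x \<and>
      norm (u x) \<le> C1 * exp (- C2 * norm x powr (2 - 2 * \<epsilon>)) \<and>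
      (norm x < 2 \<longrightarrow> V x = 0) \<and> norm (V x) \<le> C3 * norm x powr (- \<epsilon>))"
proof -
  define u where "u x = (\<Sum>c\<in>I. patch y W c x)" for x
  let ?E = "\<lambda>x :: real^'n. exp (- (norm x powr (2 - 2 * \<epsilon>)))"
  have Cp: "C_class_on k UNIV (patch y W c)" if "c \<in> I" for c k
    by (rule C_class_on_patch[OF y]) (rule W[OF that])
  have Cu: "C_class_on k UNIV u" for k
    unfolding u_def[abs_def] by (intro C_class_on_sum Cp) auto
  obtain M where M: "M > 0" and bound:
    "\<And>c x Q B. (\<And>i j. \<bar>partial j (y i) x\<bar> \<le> Q) \<Longrightarrow>
      (centred y c x \<Longrightarrow> W c (cell y c x) differentiable (at x)) \<Longrightarrow>
      (centred y c x \<Longrightarrow> dirac \<alpha> (W c (cell y c x)) x = 0) \<Longrightarrow>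
      (centred y c x \<Longrightarrow> norm (W c (cell y c x) x) \<le> B) \<Longrightarrow> B \<ge> 0 \<Longrightarrow>
      norm (dirac \<alpha> (patch y W c) x) \<le> M * Q * B"
  proof (rule dirac_patch_bound[where \<alpha>=\<alpha> and 'd='d])
    fix M :: real
    assume M: "M > 0" and *: "\<And>(y :: 'd \<Rightarrow> real^'n \<Rightarrow> real) (W :: nat \<Rightarrow> ('d \<Rightarrow> int) \<Rightarrow> real^'n \<Rightarrow> complex^'m) c x Q B.
      (\<And>k i. C_class_on k UNIV (y i)) \<Longrightarrow>
      (\<And>i j. \<bar>partial j (y i) x\<bar> \<le> Q) \<Longrightarrow>
      (centred y c x \<Longrightarrow> W c (cell y c x) differentiable (at x)) \<Longrightarrow>
      (centred y c x \<Longrightarrow> dirac \<alpha> (W c (cell y c x)) x = 0) \<Longrightarrow>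
      (centred y c x \<Longrightarrow> norm (W c (cell y c x) x) \<le> B) \<Longrightarrow> B \<ge> 0 \<Longrightarrow>
      norm (dirac \<alpha> (patch y W c) x) \<le> M * Q * B"
    show thesis by (rule that[OF M *[OF y]])
  qed
  have Wd: "W c (cell y c x) differentiable (at x)" if "c \<in> I" "centred y c x" for c x
    using W[OF that] C_class_on_SucD[of 0 _ "W c (cell y c x)" x] unfolding differentiable_def by blast
  have du: "dirac \<alpha> u x = (\<Sum>c\<in>I. dirac \<alpha> (patch y W c) x)" for x
    unfolding u_def[abs_def] using Cp[of _ "Suc 0"] by (intro dirac_sum fin) auto
  have near: "dirac \<alpha> u x = 0" if x: "norm x < 2" for x
  proof -
    have "partial j (y i) x = 0" for i j
      by (rule partial_eq_0[of "ball 0 2"]) (use x y0 in auto)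
    then have "norm (dirac \<alpha> (patch y W c) x) \<le> M * 0 * norm (W c (cell y c x) x)" if "c \<in> I" for c
      using that by (intro bound Wd dW) auto
    then show ?thesis unfolding du by simp
  qed
  define L where "L = card I * M * K * \<bar>K\<bar> / k"
  have far: "norm (dirac \<alpha> u x) \<le> L * norm x powr (- \<epsilon>) * norm (u x)" if x: "norm x \<ge> R" for x
  proof -
    obtain j :: 'n and i :: 'd where True by auto
    have K: "K * norm x powr (- \<epsilon>) \<ge> 0"
      using y1[OF x, of j i] abs_ge_zero order.trans by blast
    moreover have "norm x powr (- \<epsilon>) > 0" using x R by auto
    ultimately have K0: "K \<ge> 0" by (simp add: zero_le_mult_iff)
    have "norm (dirac \<alpha> (patch y W c) x) \<le> M * (K * norm x powr (- \<epsilon>)) * (\<bar>K\<bar> * ?E x)" if "c \<in> I" for c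
    proof (rule bound)
      show "norm (W c (cell y c x) x) \<le> \<bar>K\<bar> * ?E x" if "centred y c x"
        by (rule order.trans[OF up[OF \<open>c \<in> I\<close> that x]]) (intro mult_right_mono; simp)
    qed (use that Wd dW y1[OF x] in auto)
    then have "norm (dirac \<alpha> u x) \<le> (\<Sum>c\<in>I. M * (K * norm x powr (- \<epsilon>)) * (\<bar>K\<bar> * ?E x))"
      unfolding du by (rule sum_norm_le)
    also have "\<dots> = card I * M * (K * norm x powr (- \<epsilon>)) * \<bar>K\<bar> * ?E x"
      by simp
    also have "\<dots> \<le> card I * M * (K * norm x powr (- \<epsilon>)) * \<bar>K\<bar> * (norm (u x) / k)"
      using low[OF x] M K0 k
      by (intro mult_left_mono mult_nonneg_nonneg) (auto simp: u_def pos_le_divide_eq mult.commute)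
    finally show ?thesis by (simp add: L_def field_simps)
  qed
  obtain V C3 where V: "smooth V" "\<exists>x. V x \<noteq> 0" "C3 > 0" "\<And>x. dirac \<alpha> u x = V x *v u x"
    "\<And>x. norm x < 2 \<Longrightarrow> V x = 0" "\<And>x. norm (V x) \<le> C3 * norm x powr (- \<epsilon>)"
  proof -
    have "smooth u" "u x \<noteq> 0" for x using Cu nz by (auto simp: smooth_iff u_def)
    from potential_exists[OF card this near far R] show thesis using that by blast
  qed
  have "continuous_on (cball 0 R) u" using Cu[of 0] by (auto intro: continuous_on_subset)
  then have "bounded (u ` cball 0 R)"
    by (intro compact_imp_bounded compact_continuous_image) auto
  then obtain B where B: "B > 0" "\<And>x. norm x \<le> R \<Longrightarrow> norm (u x) \<le> B"
    by (auto simp: bounded_pos)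
  define C1 where "C1 = max (card I * \<bar>K\<bar>) (B * exp (R powr (2 - 2 * \<epsilon>)))"
  have decay: "norm (u x) \<le> C1 * ?E x" for x
  proof (cases "norm x \<ge> R")
    case True
    have "norm (patch y W c x) \<le> \<bar>K\<bar> * ?E x" if "c \<in> I" for c
    proof (cases "centred y c x")
      case T: True
      have "norm (patch y W c x) \<le> 1 * norm (W c (cell y c x) x)"
        unfolding patch_def norm_scaleR using weight_nonneg[of y c x] weight_le_1[of y c x]
        by (intro mult_right_mono) auto
      also have "\<dots> \<le> K * ?E x" using up[OF that T True] by simp
      also have "\<dots> \<le> \<bar>K\<bar> * ?E x" by (intro mult_right_mono) auto
      finally show ?thesis .
    qed (simp add: patch_eq_0)
    then have "norm (u x) \<le> (\<Sum>c\<in>I. \<bar>K\<bar> * ?E x)"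
      unfolding u_def by (rule sum_norm_le)
    also have "\<dots> = (card I * \<bar>K\<bar>) * ?E x" by simp
    also have "\<dots> \<le> C1 * ?E x" unfolding C1_def by (intro mult_right_mono) auto
    finally show ?thesis .
  next
    case False
    then have "norm x powr (2 - 2 * \<epsilon>) \<le> R powr (2 - 2 * \<epsilon>)"
      using eps by (intro powr_mono2) auto
    then have "1 \<le> exp (R powr (2 - 2 * \<epsilon>)) * ?E x"
      by (simp flip: exp_add)
    then have "B * 1 \<le> B * (exp (R powr (2 - 2 * \<epsilon>)) * ?E x)"
      using B(1) by (intro mult_left_mono) auto
    also have "\<dots> = (B * exp (R powr (2 - 2 * \<epsilon>))) * ?E x" by simp
    also have "\<dots> \<le> C1 * ?E x" unfolding C1_def by (intro mult_right_mono) auto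
    finally show ?thesis using B(2)[of x] False by simp
  qed
  have "C1 > 0" using B by (simp add: C1_def less_max_iff_disj)
  then show ?thesis
    using V decay Cu nz
    by (intro exI[of _ u] exI[of _ V] conjI exI[of _ C1] exI[of _ "1::real"] exI[of _ C3] allI)
      (auto simp: smooth_iff u_def)
qed

section \<open>Cells and colours\<close>

definition cut_powr :: "real \<Rightarrow> real^'n \<Rightarrow> real"
  where "cut_powr a x = step (x \<bullet> x - 4) * (x \<bullet> x) powr (a / 2)"

lemma C_class_on_cut_powr: "C_class_on k UNIV (cut_powr a :: real^'n \<Rightarrow> real)"
proof (rule C_class_on_local)
  fix x :: "real^'n"
  show "\<exists>T. open T \<and> x \<in> T \<and> C_class_on k T (cut_powr a)"
  proof (cases "x \<bullet> x < 4")
    case True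
    let ?T = "{x :: real^'n. x \<bullet> x < 4}"
    have T: "open ?T" by (intro open_Collect_less continuous_intros)
    have "C_class_on k ?T (cut_powr a)"
      by (rule C_class_on_cong[OF T _ C_class_on_const[OF T, of k 0]]) (simp add: cut_powr_def step_eq_0)
    then show ?thesis using T True by blast
  next
    case False
    let ?T = "{x :: real^'n. x \<bullet> x > 0}"
    have T: "open ?T" by (intro open_Collect_less continuous_intros)
    have I: "C_class_on k ?T (\<lambda>x. x \<bullet> x)" by (rule C_class_on_subset[OF C_class_on_inner_self subset_UNIV])
    have "C_class_on k ?T (cut_powr a)"
      unfolding cut_powr_def[abs_def]
      by (intro C_class_on_mult C_class_on_step C_class_on_diff C_class_on_powr C_class_on_const I T) auto
    then show ?thesis using T False by force
  qed
qed auto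

lemma cut_powr_near: "norm x < 2 \<Longrightarrow> cut_powr a x = 0"
proof -
  assume "norm x < 2"
  then have "(norm x)\<^sup>2 \<le> 2\<^sup>2" by (intro power_mono) auto
  then show ?thesis by (simp add: cut_powr_def step_eq_0 power2_norm_eq_inner)
qed

lemma inner_self_ge_9: "norm (x :: real^'n) \<ge> 3 \<Longrightarrow> x \<bullet> x \<ge> 9"
  using power_mono[of 3 "norm x" 2] by (simp add: power2_norm_eq_inner)

lemma inner_self_powr: "(x \<bullet> x) powr a = norm (x :: real^'n) powr (2 * a)"
  by (cases "x = 0") (simp_all add: dot_square_norm powr_powr[symmetric] powr_numeral)

lemma cut_powr_far: "norm x \<ge> 3 \<Longrightarrow> cut_powr a x = norm x powr a"
  using inner_self_ge_9[of x] by (cases "x = 0") (auto simp: cut_powr_def step_eq_1 inner_self_powr)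

lemma cut_powr_has_derivative:
  assumes "norm x \<ge> 3"
  shows "(cut_powr a has_derivative (\<lambda>h. a * norm x powr (a - 2) * (x \<bullet> h))) (at x)"
proof (rule has_derivative_transform_within_open[of "\<lambda>x. (x \<bullet> x) powr (a / 2)" _ _ _ "{x. x \<bullet> x > 5}"])
  have pos: "x \<bullet> x > 0" using inner_self_ge_9[OF assms] by linarith
  have i: "((\<lambda>x. x \<bullet> x) has_derivative (\<lambda>h. 2 * (x \<bullet> h))) (at x)"
    by (auto intro!: derivative_eq_intros simp: inner_commute)
  have "((\<lambda>t. t powr (a / 2)) has_derivative (*) (a / 2 * (x \<bullet> x) powr (a / 2 - 1))) (at (x \<bullet> x))"
    using has_real_derivative_powr[OF pos, of "a / 2"] by (simp add: has_field_derivative_def)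
  from has_derivative_compose[OF i this]
  have "((\<lambda>x. (x \<bullet> x) powr (a / 2)) has_derivative (\<lambda>h. a / 2 * (x \<bullet> x) powr (a / 2 - 1) * (2 * (x \<bullet> h)))) (at x)" .
  then show "((\<lambda>x. (x \<bullet> x) powr (a / 2)) has_derivative (\<lambda>h. a * norm x powr (a - 2) * (x \<bullet> h))) (at x)"
    unfolding inner_self_powr by (rule has_derivative_eq_rhs) (auto simp: algebra_simps)
  show "open {x :: real^'a. x \<bullet> x > 5}" by (intro open_Collect_less continuous_intros)
  show "x \<in> {x. x \<bullet> x > 5}" using inner_self_ge_9[OF assms] by simp
  show "\<And>x. x \<in> {x. x \<bullet> x > 5} \<Longrightarrow> (x \<bullet> x) powr (a / 2) = cut_powr a x"
    by (simp add: cut_powr_def step_eq_1)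
qed

lemma partial_cut_powr_bound:
  assumes "norm x \<ge> 3"
  shows "\<bar>partial j (cut_powr a) x\<bar> \<le> \<bar>a\<bar> * norm x powr (a - 1)"
proof -
  have "\<bar>x \<bullet> axis j 1\<bar> \<le> norm x" by (simp add: inner_axis component_le_norm_cart)
  then have "\<bar>partial j (cut_powr a) x\<bar> \<le> \<bar>a\<bar> * norm x powr (a - 2) * norm x"
    unfolding partial_eqI[OF cut_powr_has_derivative[OF assms]] abs_mult
    by (intro mult_mono) auto
  also have "norm x powr (a - 1) = norm x powr (a - 2) * norm x powr 1"
    unfolding powr_add[symmetric] by simp
  ultimately show ?thesis using assms by simp
qed

text \<open>For a fixed coordinate, at most one of the four shifts can put it within the margin of a multiple
  of 4: the cosines for two different shifts are \<open>cos A\<close> and one of \<open>- cos A\<close>, \<open>sin A\<close>, \<open>- sin A\<close>.\<close>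

lemma good_colour:
  fixes y :: "'d::finite \<Rightarrow> 'a \<Rightarrow> real"
  assumes "I \<subseteq> {..<4}" "card I > CARD('d)"
  obtains c where "c \<in> I" "\<And>i. cos (pi / 2 * (y i x - real c)) \<le> 3 / 4"
proof (rule ccontr)
  assume "\<not> thesis"
  then have "\<forall>c\<in>I. \<exists>i. cos (pi / 2 * (y i x - real c)) > 3 / 4"
    using that by (meson not_le)
  then obtain f where f: "\<And>c. c \<in> I \<Longrightarrow> cos (pi / 2 * (y (f c) x - real c)) > 3 / 4"
    by metis
  have *: False if cc: "c < c'" "c' < 4" "cos (pi / 2 * (t - real c)) > 3 / 4"
    "cos (pi / 2 * (t - real c')) > 3 / 4" for c c' :: nat and t :: real
  proof -
    define A where "A = pi / 2 * (t - real c)"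
    have B: "pi / 2 * (t - real c') = A - pi / 2 * real (c' - c)"
      using cc(1) by (simp add: A_def of_nat_diff right_diff_distrib)
    have sq: "s \<le> 3 / 4" "- s \<le> 3 / 4" if "s\<^sup>2 + (cos A)\<^sup>2 = 1" for s
    proof -
      have "(3/4)\<^sup>2 < (cos A)\<^sup>2" using cc(3) by (intro power_strict_mono) (auto simp: A_def)
      then have "\<bar>s\<bar>\<^sup>2 \<le> (3/4)\<^sup>2" using that by (simp add: power2_eq_square)
      then have "\<bar>s\<bar> \<le> 3/4" by (rule power2_le_imp_le) simp
      then show "s \<le> 3 / 4" "- s \<le> 3 / 4" by auto
    qed
    consider "c' - c = 1" | "c' - c = 2" | "c' - c = 3" using cc by linarith
    then show False
    proof cases
      case 1
      then have "cos (pi / 2 * (t - real c')) = sin A"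
        unfolding B by (simp add: cos_diff)
      then show False using sq(1)[of "sin A"] cc(4) by simp
    next
      case 2
      then have "cos (pi / 2 * (t - real c')) = - cos A"
        unfolding B by (simp add: cos_diff)
      then show False using cc(3,4) by (simp add: A_def)
    next
      case 3
      have "cos (A - pi / 2 * 3) = - sin A"
        using cos_diff[of "A - pi" "pi / 2"] by (simp add: sin_diff algebra_simps)
      then have "cos (pi / 2 * (t - real c')) = - sin A"
        unfolding B 3 by simp
      then show False using sq(2)[of "sin A"] cc(4) by simp
    qed
  qed
  have "inj_on f I"
  proof (rule linorder_inj_onI)
    fix c c' assume "c < c'" "c \<in> I" "c' \<in> I"
    then show "f c \<noteq> f c'"
      using *[of c c' "y (f c) x"] f[of c] f[of c'] assms(1) by auto
  qed auto
  then have "card I \<le> CARD('d)" by (intro card_inj_on_le[of f]) auto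
  then show False using assms(2) by simp
qed

lemma bump_lower:
  assumes "cos (pi / 2 * t) \<le> 3 / 4"
  shows "bump t \<ge> exp (- 40)"
proof -
  define s where "s = 2 / 5 - cos (pi / 2 * t) / 2"
  have "s \<ge> 1 / 40" using assms unfolding s_def by linarith
  then have "1 / s \<le> 40" by (simp add: divide_simps)
  then show ?thesis using \<open>s \<ge> 1 / 40\<close> unfolding bump_def s_def[symmetric] by (simp add: flat_def)
qed

lemma weight_lower:
  fixes y :: "'d::finite \<Rightarrow> 'a \<Rightarrow> real"
  assumes "\<And>i. cos (pi / 2 * (y i x - real c)) \<le> 3 / 4"
  shows "weight y c x \<ge> exp (- 40) ^ CARD('d)" "centred y c x"
proof -
  show "weight y c x \<ge> exp (- 40) ^ CARD('d)"
    unfolding weight_def using bump_lower[OF assms]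
    by (subst prod_constant[symmetric]) (intro prod_mono; simp)
  have "cos (pi / 2 * (y i x - real c)) \<le> 4 / 5" for i using assms[of i] by linarith
  then show "centred y c x" by (simp add: centred_def)
qed

definition cell_centre :: "nat \<Rightarrow> int \<Rightarrow> real"
  where "cell_centre c m = 4 * of_int m + real c + 2"

lemma cell_centre_dist: "\<bar>y i x - cell_centre c (cell y c x i)\<bar> \<le> 2"
proof -
  have *: "\<bar>t - (4 * of_int m + real c + 2)\<bar> \<le> 2"
    if "of_int m \<le> (t - real c) / 4" "(t - real c) / 4 < of_int m + 1" for t :: real and m :: int
    using that by (simp add: abs_le_iff pos_le_divide_eq pos_divide_less_eq)
  show ?thesis
    unfolding cell_centre_def cell_def by (rule *[OF of_int_floor_le]) linarith
qed

lemma quadratic_bound: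
  fixes G G' G'' :: "real \<Rightarrow> real"
  assumes G: "\<And>t. t \<in> {1/2..2} \<Longrightarrow> (G has_real_derivative G' t) (at t)"
    and G': "\<And>t. t \<in> {1/2..2} \<Longrightarrow> (G' has_real_derivative G'' t) (at t)"
    and G'': "continuous_on {1/2..2} G''" and 0: "G 1 = 0" "G' 1 = 0"
  obtains C where "C > 0" "\<And>t. t \<in> {1/2..2} \<Longrightarrow> \<bar>G t\<bar> \<le> C * (t - 1)\<^sup>2"
proof -
  have "bounded (G'' ` {1/2..2})"
    by (intro compact_imp_bounded compact_continuous_image G'') auto
  then obtain C where C: "C > 0" "\<And>t. t \<in> {1/2..2} \<Longrightarrow> \<bar>G'' t\<bar> \<le> C"
    by (auto simp: bounded_pos)
  have b': "\<bar>G' t\<bar> \<le> C * \<bar>t - 1\<bar>" if "t \<in> {1/2..2}" for t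
    using field_differentiable_bound[of "{1/2..2}" G' G'' C t 1] C(2) that 0
      has_field_derivative_at_within[OF G'] by auto
  have "\<bar>G t\<bar> \<le> C * (t - 1)\<^sup>2" if t: "t \<in> {1/2..2}" for t
  proof -
    have sub: "s \<in> {1/2..2} \<and> \<bar>s - 1\<bar> \<le> \<bar>t - 1\<bar>" if "s \<in> closed_segment 1 t" for s
      using that t by (auto simp: closed_segment_eq_real_ivl split: if_splits)
    have "\<bar>G' s\<bar> \<le> C * \<bar>t - 1\<bar>" if "s \<in> closed_segment 1 t" for s
      using b'[of s] sub[OF that] mult_left_mono[of "\<bar>s - 1\<bar>" "\<bar>t - 1\<bar>" C] C(1) by linarith
    then have "\<bar>G t - G 1\<bar> \<le> C * \<bar>t - 1\<bar> * \<bar>t - 1\<bar>"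
      using field_differentiable_bound[of "closed_segment 1 t" G G' "C * \<bar>t - 1\<bar>" t 1]
        has_field_derivative_at_within[OF G] sub by (auto simp: abs_minus_commute)
    then show ?thesis using 0 by (simp add: power2_eq_square mult.assoc flip: abs_mult)
  qed
  then show thesis using that C(1) by blast
qed

section \<open>The planar case\<close>

definition complex_of_plane :: "real^2 \<Rightarrow> complex"
  where "complex_of_plane x = Complex (x $ 1) (x $ 2)"

lemma bounded_linear_complex_of_plane: "bounded_linear complex_of_plane"
  by (intro linear_conv_bounded_linear[THEN iffD1] linearI) (auto simp: complex_of_plane_def complex_eq_iff)

lemma norm_complex_of_plane: "norm (complex_of_plane x) = norm x"
  by (simp add: complex_of_plane_def cmod_def norm_vec_def L2_set_def UNIV_2)

lemma complex_of_plane_axis: "complex_of_plane (axis 1 1) = 1" "complex_of_plane (axis 2 1) = \<i>"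
  by (simp_all add: complex_of_plane_def axis_def complex_eq_iff)

definition plane_spinor :: "nat \<Rightarrow> complex \<Rightarrow> complex^2"
  where "plane_spinor c w = (if c = 0 then vector [w, 0] else vector [0, cnj w])"

lemma bounded_linear_plane_spinor: "bounded_linear (plane_spinor c)"
  by (intro linear_conv_bounded_linear[THEN iffD1] linearI)
    (auto simp: plane_spinor_def vec_eq_iff forall_2 complex_eq_iff)

lemma norm_plane_spinor: "norm (plane_spinor c w) = norm w"
  by (simp add: plane_spinor_def norm_vec_def L2_set_def UNIV_2)

text \<open>Upper components holomorphic, lower components antiholomorphic: the null space of the planar
  Dirac operator.\<close>

lemma dirac_plane_spinor:
  assumes "(f has_field_derivative f') (at (complex_of_plane x))"
  shows "dirac alpha2 (\<lambda>x. plane_spinor c (f (complex_of_plane x))) x = 0"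
proof -
  have "((\<lambda>x. plane_spinor c (f (complex_of_plane x))) has_derivative (\<lambda>h. plane_spinor c (f' * complex_of_plane h))) (at x)"
    by (rule bounded_linear.has_derivative[OF bounded_linear_plane_spinor])
      (rule has_derivative_compose[OF bounded_linear_imp_has_derivative[OF bounded_linear_complex_of_plane]
        assms[unfolded has_field_derivative_def]])
  then have p: "partial j (\<lambda>x. plane_spinor c (f (complex_of_plane x))) x = plane_spinor c (f' * complex_of_plane (axis j 1))" for j
    by (rule partial_eqI)
  show ?thesis
    unfolding dirac_def p sum_2 complex_of_plane_axis
    by (auto simp: alpha2_def pauli1_def pauli2_def plane_spinor_def
        vec_eq_iff forall_2 matrix_vector_mult_def sum_2)
qed

lemma C_class_on_power:
  fixes f :: "real^'n \<Rightarrow> 'b::real_normed_field"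
  assumes "open S" "C_class_on k S f"
  shows "C_class_on k S (\<lambda>x. f x ^ n)"
  by (induction n) (auto intro!: C_class_on_const C_class_on_mult assms)

definition plane_radius :: "real \<Rightarrow> nat \<Rightarrow> int \<Rightarrow> real"
  where "plane_radius \<epsilon> c m = \<bar>cell_centre c m\<bar> powr (1 / (1 - \<epsilon>))"

definition plane_exponent :: "real \<Rightarrow> nat \<Rightarrow> int \<Rightarrow> nat"
  where "plane_exponent \<epsilon> c m = nat \<lfloor>2 * (1 - \<epsilon>) * (cell_centre c m)\<^sup>2\<rfloor>"

definition plane_piece :: "real \<Rightarrow> nat \<Rightarrow> int \<Rightarrow> complex \<Rightarrow> complex"
  where "plane_piece \<epsilon> c m z =
    of_real (exp (- (cell_centre c m)\<^sup>2)) * (of_real (plane_radius \<epsilon> c m) * inverse z) ^ plane_exponent \<epsilon> c m"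

lemma log_quadratic_bound:
  obtains C :: real where "C > 0"
    "\<And>t. t \<in> {1/2..2} \<Longrightarrow> \<bar>t\<^sup>2 - 1 - 2 * ln t\<bar> \<le> C * (t - 1)\<^sup>2"
proof (rule quadratic_bound[where G="\<lambda>t. t\<^sup>2 - 1 - 2 * ln t" and G'="\<lambda>t. 2 * t - 2 / t" and G''="\<lambda>t. 2 + 2 / t\<^sup>2"])
  show "continuous_on {1/2..2} (\<lambda>t::real. 2 + 2 / t\<^sup>2)"
    by (intro continuous_intros) auto
  show "((\<lambda>t. t\<^sup>2 - 1 - 2 * ln t) has_real_derivative 2 * t - 2 / t) (at t)" if "t \<in> {1/2..2}" for t
    using that by (auto intro!: derivative_eq_intros simp: field_simps)
  show "((\<lambda>t. 2 * t - 2 / t) has_real_derivative 2 + 2 / t\<^sup>2) (at t)" if "t \<in> {1/2..2}" for t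
    using that by (auto intro!: derivative_eq_intros simp: field_simps power2_eq_square)
qed (auto intro: that)

lemma near_ratio:
  fixes s t :: real
  assumes "t \<ge> 8" "\<bar>t - s\<bar> \<le> 4"
  shows "s \<ge> 4" "t / s \<in> {1/2..2}"
  using assms by (auto simp: field_simps abs_le_iff)

lemma plane_piece_size:
  assumes eps: "\<epsilon> < 1"
  obtains D :: real where "\<And>c m z. norm z powr (1 - \<epsilon>) \<ge> 8 \<Longrightarrow>
    \<bar>norm z powr (1 - \<epsilon>) - cell_centre c m\<bar> \<le> 2 \<Longrightarrow>
    norm (plane_piece \<epsilon> c m z) \<ge> exp (- D) * exp (- (norm z powr (2 - 2 * \<epsilon>))) \<and>
    norm (plane_piece \<epsilon> c m z) \<le> exp D * exp (- (norm z powr (2 - 2 * \<epsilon>)))"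
proof -
  obtain C :: real where C: "C > 0"
    "\<And>t. t \<in> {1/2..2} \<Longrightarrow> \<bar>t\<^sup>2 - 1 - 2 * ln t\<bar> \<le> C * (t - 1)\<^sup>2"
    using log_quadratic_bound by blast
  show thesis
  proof (rule that[of "4 * C + 1 / (1 - \<epsilon>)"])
    fix c m and z :: complex
    define t where "t = norm z powr (1 - \<epsilon>)"
    define s where "s = cell_centre c m"
    define n where "n = plane_exponent \<epsilon> c m"
    assume "norm z powr (1 - \<epsilon>) \<ge> 8" "\<bar>norm z powr (1 - \<epsilon>) - cell_centre c m\<bar> \<le> 2"
    then have t: "t \<ge> 8" and ts: "\<bar>t - s\<bar> \<le> 2" by (simp_all add: t_def s_def)
    note s = near_ratio[OF t, of s]
    have s4: "s \<ge> 4" and \<rho>: "t / s \<in> {1/2..2}" using s ts by auto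
    have z: "norm z > 0" using t by (auto simp: t_def)
    have nz: "norm z = t powr (1 / (1 - \<epsilon>))"
      using eps z by (simp add: t_def powr_powr)
    have t2: "norm z powr (2 - 2 * \<epsilon>) = t\<^sup>2"
      using z by (simp add: t_def powr_powr flip: powr_numeral) (simp add: algebra_simps)
    have "plane_radius \<epsilon> c m * inverse (norm z) = (t / s) powr (- 1 / (1 - \<epsilon>))"
      using s4 t by (simp add: plane_radius_def nz flip: s_def)
        (simp add: powr_divide powr_minus field_simps)
    also have "\<dots> = exp (- (ln (t / s) / (1 - \<epsilon>)))"
      using s4 t by (simp add: powr_def)
    finally have r: "plane_radius \<epsilon> c m * inverse (norm z) = exp (- (ln (t / s) / (1 - \<epsilon>)))" .
    have "norm (plane_piece \<epsilon> c m z) = exp (- s\<^sup>2) * (plane_radius \<epsilon> c m * inverse (norm z)) ^ n"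
      by (simp add: plane_piece_def norm_mult norm_power norm_inverse plane_radius_def s_def n_def)
    also have "\<dots> = exp (- s\<^sup>2 - n * (ln (t / s) / (1 - \<epsilon>)))"
      unfolding r by (simp add: exp_of_nat_mult[symmetric] mult_exp_exp)
    finally have norm: "norm (plane_piece \<epsilon> c m z) = exp (- s\<^sup>2 - n * (ln (t / s) / (1 - \<epsilon>)))" .
    define \<theta> where "\<theta> = 2 * (1 - \<epsilon>) * s\<^sup>2 - n"
    have "2 * (1 - \<epsilon>) * s\<^sup>2 \<ge> 0" using eps by simp
    then have \<theta>: "0 \<le> \<theta>" "\<theta> \<le> 1"
      unfolding \<theta>_def n_def plane_exponent_def s_def[symmetric] by linarith+
    have n: "n / (1 - \<epsilon>) = 2 * s\<^sup>2 - \<theta> / (1 - \<epsilon>)"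
      using eps by (simp add: \<theta>_def field_simps)
    have "- s\<^sup>2 - n * (ln (t / s) / (1 - \<epsilon>)) + t\<^sup>2 =
        s\<^sup>2 * ((t / s)\<^sup>2 - 1 - 2 * ln (t / s)) + \<theta> / (1 - \<epsilon>) * ln (t / s)"
    proof -
      have "n * (ln (t / s) / (1 - \<epsilon>)) = (2 * s\<^sup>2 - \<theta> / (1 - \<epsilon>)) * ln (t / s)"
        unfolding n[symmetric] by simp
      then show ?thesis using s4 by (simp add: algebra_simps power_divide)
    qed
    moreover have "\<bar>s\<^sup>2 * ((t / s)\<^sup>2 - 1 - 2 * ln (t / s))\<bar> \<le> 4 * C"
    proof -
      have "\<bar>s\<^sup>2 * ((t / s)\<^sup>2 - 1 - 2 * ln (t / s))\<bar> \<le> s\<^sup>2 * (C * (t / s - 1)\<^sup>2)"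
        unfolding abs_mult using C(2)[OF \<rho>] by (intro mult_mono) auto
      also have "\<dots> = C * (t - s)\<^sup>2"
        using s4 by (simp add: power2_eq_square field_simps)
      also have "\<dots> \<le> C * 2\<^sup>2"
        using ts C(1) abs_le_square_iff[of "t - s" 2] by (intro mult_left_mono) auto
      finally show ?thesis by simp
    qed
    moreover have "\<bar>\<theta> / (1 - \<epsilon>) * ln (t / s)\<bar> \<le> 1 / (1 - \<epsilon>)"
    proof -
      have "\<bar>ln (t / s)\<bar> \<le> ln 2"
      proof -
        have "ln (t / s) \<le> ln 2" "ln (1 / 2) \<le> ln (t / s)"
          using \<rho> s4 t by (auto intro!: ln_mono simp: pos_le_divide_eq)
        then show ?thesis by (simp add: ln_div)
      qed
      then have "\<bar>ln (t / s)\<bar> \<le> 1" using ln_2_less_1 by linarith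
      then have "\<bar>\<theta> / (1 - \<epsilon>) * ln (t / s)\<bar> \<le> 1 / (1 - \<epsilon>) * 1"
        unfolding abs_mult using \<theta> eps by (intro mult_mono) (auto simp: divide_right_mono)
      then show ?thesis by simp
    qed
    moreover have *: "- D + - b \<le> a \<and> a \<le> D + - b" if "\<bar>a + b\<bar> \<le> D" for a b D :: real
      using that by linarith
    ultimately have "\<bar>- s\<^sup>2 - n * (ln (t / s) / (1 - \<epsilon>)) + t\<^sup>2\<bar> \<le> 4 * C + 1 / (1 - \<epsilon>)"
      by linarith
    then show "norm (plane_piece \<epsilon> c m z) \<ge> exp (- (4 * C + 1 / (1 - \<epsilon>))) * exp (- (norm z powr (2 - 2 * \<epsilon>))) \<and>
      norm (plane_piece \<epsilon> c m z) \<le> exp (4 * C + 1 / (1 - \<epsilon>)) * exp (- (norm z powr (2 - 2 * \<epsilon>)))"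
      unfolding norm t2 exp_add[symmetric] exp_le_cancel_iff by (rule *)
  qed
qed

text \<open>Of the four possible colours 0 and 2 are used, because then the cell that contains the origin has
  centre 0 and exponent 0: the piece there is constant and the pole of \<open>1 / z\<close> is avoided.\<close>

theorem plane_case:
  fixes \<epsilon> :: real
  assumes eps: "\<epsilon> < 1"
  shows "\<exists>(u :: real^2 \<Rightarrow> complex^2) (V :: real^2 \<Rightarrow> complex^2^2).
    smooth u \<and> smooth V \<and> (\<exists>x. u x \<noteq> 0) \<and> (\<exists>x. V x \<noteq> 0) \<and>
    (\<exists>C1>0. \<exists>C2>0. \<exists>C3>0. \<forall>x. dirac alpha2 u x = V x *v u x \<and>
      norm (u x) \<le> C1 * exp (- C2 * norm x powr (2 - 2 * \<epsilon>)) \<and>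
      (norm x < 2 \<longrightarrow> V x = 0) \<and> norm (V x) \<le> C3 * norm x powr (- \<epsilon>))"
proof -
  obtain D where D: "\<And>c m z. norm z powr (1 - \<epsilon>) \<ge> 8 \<Longrightarrow>
    \<bar>norm z powr (1 - \<epsilon>) - cell_centre c m\<bar> \<le> 2 \<Longrightarrow>
    norm (plane_piece \<epsilon> c m z) \<ge> exp (- D) * exp (- (norm z powr (2 - 2 * \<epsilon>))) \<and>
    norm (plane_piece \<epsilon> c m z) \<le> exp D * exp (- (norm z powr (2 - 2 * \<epsilon>)))"
    using plane_piece_size[OF eps] by blast
  define y :: "unit \<Rightarrow> real^2 \<Rightarrow> real" where "y = (\<lambda>_. cut_powr (1 - \<epsilon>))"
  define W :: "nat \<Rightarrow> (unit \<Rightarrow> int) \<Rightarrow> real^2 \<Rightarrow> complex^2"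
    where "W = (\<lambda>c m x. plane_spinor c (plane_piece \<epsilon> c (m ()) (complex_of_plane x)))"
  define R where "R = max 3 (8 powr (1 / (1 - \<epsilon>)))"
  have far: "y i x = norm x powr (1 - \<epsilon>)" "y i x \<ge> 8" if x: "norm x \<ge> R" for i x
  proof -
    have "norm x \<ge> 3" "norm x \<ge> 8 powr (1 / (1 - \<epsilon>))" using x by (auto simp: R_def)
    from this(1) show 1: "y i x = norm x powr (1 - \<epsilon>)"
      by (simp add: y_def cut_powr_far)
    have "(8 powr (1 / (1 - \<epsilon>))) powr (1 - \<epsilon>) \<le> norm x powr (1 - \<epsilon>)"
      using eps x by (intro powr_mono2) (auto simp: R_def)
    then show "y i x \<ge> 8" using eps unfolding 1 by (simp add: powr_powr)
  qed
  have size: "norm (W c (cell y c x) x) \<ge> exp (- D) * exp (- (norm x powr (2 - 2 * \<epsilon>)))"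
    "norm (W c (cell y c x) x) \<le> exp D * exp (- (norm x powr (2 - 2 * \<epsilon>)))"
    if "norm x \<ge> R" for c x
    using D[of "complex_of_plane x" c "cell y c x ()"] cell_centre_dist[of y "()" x c] far[OF that, of "()"]
    by (simp_all add: W_def norm_plane_spinor norm_complex_of_plane)
  have origin: "plane_exponent \<epsilon> c (cell y c 0 ()) = 0 \<and> c = 2" if "c \<in> {0, 2}" "centred y c 0" for c
  proof -
    have "y i 0 = 0" for i by (simp add: y_def cut_powr_near)
    then have "cell y c 0 () = (if c = 0 then 0 else - 1)" "c \<noteq> 0"
      using that by (auto simp: cell_def centred_def)
    then show ?thesis using that by (auto simp: plane_exponent_def cell_centre_def)
  qed
  have deriv: "\<exists>d. (plane_piece \<epsilon> c m has_field_derivative d) (at z)"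
    if "z \<noteq> 0 \<or> plane_exponent \<epsilon> c m = 0" for c m z
  proof (cases "z = 0")
    case True
    then have "plane_piece \<epsilon> c m = (\<lambda>_. of_real (exp (- (cell_centre c m)\<^sup>2)))"
      using that by (auto simp: plane_piece_def)
    then show ?thesis using DERIV_const by metis
  next
    case False
    then show ?thesis
      unfolding plane_piece_def[abs_def] by (auto intro!: exI derivative_eq_intros)
  qed
  have nonzero: "W c (cell y c x) x \<noteq> 0" if "c \<in> {0, 2}" "centred y c x" for c x
  proof -
    have "plane_piece \<epsilon> c (cell y c x ()) (complex_of_plane x) \<noteq> 0"
    proof (cases "x = 0")
      case True
      then show ?thesis using origin that by (auto simp: plane_piece_def)
    next
      case False
      then have "complex_of_plane x \<noteq> 0" using norm_complex_of_plane[of x] by auto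
      moreover have "plane_radius \<epsilon> c (cell y c x ()) \<noteq> 0 \<or> plane_exponent \<epsilon> c (cell y c x ()) = 0"
        by (auto simp: plane_radius_def plane_exponent_def)
      ultimately show ?thesis by (auto simp: plane_piece_def)
    qed
    then show ?thesis using norm_plane_spinor by (metis W_def norm_eq_zero)
  qed
  have lower: "norm (\<Sum>c\<in>{0, 2}. patch y W c x) \<ge> weight y c x * norm (W c (cell y c x) x)"
    if "c \<in> {0, 2}" for c x
  proof -
    define v where "v c = plane_piece \<epsilon> c (cell y c x ()) (complex_of_plane x)" for c
    have "(\<Sum>c\<in>{0, 2}. patch y W c x) = vector [weight y 0 x *\<^sub>R v 0, weight y 2 x *\<^sub>R cnj (v 2)]"
      by (simp add: patch_def W_def v_def plane_spinor_def vec_eq_iff forall_2)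
    moreover have "norm (W c (cell y c x) x) = norm (v c)"
      by (simp add: W_def v_def norm_plane_spinor)
    ultimately show ?thesis
      using that component_le_norm_cart weight_nonneg[of y c x]
        Finite_Cartesian_Product.norm_nth_le[of "vector [weight y 0 x *\<^sub>R v 0, weight y 2 x *\<^sub>R cnj (v 2)] :: complex^2" "if c = 0 then 1 else 2"]
      by (auto simp: norm_mult split: if_splits)
  qed
  have good: "\<exists>c\<in>{0, 2}. exp (- 40) \<le> weight y c x \<and> centred y c x" for x
  proof -
    obtain c where c: "c \<in> {0, 2 :: nat}" "\<And>i. cos (pi / 2 * (y i x - real c)) \<le> 3 / 4"
      by (rule good_colour[of "{0, 2 :: nat}" y x]) auto
    then show ?thesis using weight_lower[of y x c] by auto
  qed
  show ?thesis
  proof (rule patchwork[where I="{0, 2}" and y=y and W=W and R=R and K="max (exp D) (1 - \<epsilon>)" and k="exp (- 40) * exp (- D)"])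
    show "C_class_on k UNIV (y i)" for k i by (simp add: y_def C_class_on_cut_powr)
    show "y i x = 0" if "norm x < 2" for i x using that by (simp add: y_def cut_powr_near)
    show "\<bar>partial j (y i) x\<bar> \<le> max (exp D) (1 - \<epsilon>) * norm x powr (- \<epsilon>)" if "norm x \<ge> R" for i j x
    proof -
      have "\<bar>partial j (y i) x\<bar> \<le> (1 - \<epsilon>) * norm x powr (- \<epsilon>)"
        using partial_cut_powr_bound[of x j "1 - \<epsilon>"] that eps by (simp add: y_def R_def)
      also have "\<dots> \<le> max (exp D) (1 - \<epsilon>) * norm x powr (- \<epsilon>)"
        by (intro mult_right_mono) auto
      finally show ?thesis .
    qed
    show "\<exists>S. open S \<and> x \<in> S \<and> (\<forall>k. C_class_on k S (W c (cell y c x)))"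
      if "c \<in> {0, 2}" "centred y c x" for c x
    proof (cases "x = 0")
      case True
      then have "W c (cell y c x) = (\<lambda>x. plane_spinor c (of_real (exp (- (cell_centre c (cell y c 0 ()))\<^sup>2))))"
        using origin[of c] that by (auto simp: W_def plane_piece_def)
      then show ?thesis by (auto intro!: exI[of _ UNIV] C_class_on_const)
    next
      case False
      have T: "open (- {0 :: real^2})" by auto
      have "C_class_on k (- {0}) (W c (cell y c x))" for k
        unfolding W_def plane_piece_def
        by (rule C_class_on_linear_compose[OF bounded_linear_plane_spinor T])
          (intro C_class_on_mult C_class_on_power C_class_on_const C_class_on_inverse T
            C_class_on_linear_compose[OF bounded_linear_complex_of_plane T C_class_on_ident[OF T]];
            use norm_complex_of_plane in \<open>metis ComplD insertI1 norm_eq_zero\<close>)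
      then show ?thesis using False T by blast
    qed
    show "dirac alpha2 (W c (cell y c x)) x = 0" if "c \<in> {0, 2}" "centred y c x" for c x
    proof -
      have "complex_of_plane x \<noteq> 0 \<or> plane_exponent \<epsilon> c (cell y c x ()) = 0"
        using origin[of c] that norm_complex_of_plane[of x] by (cases "x = 0") auto
      from deriv[OF this] show ?thesis
        unfolding W_def using dirac_plane_spinor by blast
    qed
    show "norm (W c (cell y c x) x) \<le> max (exp D) (1 - \<epsilon>) * exp (- (norm x powr (2 - 2 * \<epsilon>)))"
      if "norm x \<ge> R" for c x
      by (rule order.trans[OF size(2)[OF that]]) (intro mult_right_mono; simp)
    show "norm (\<Sum>c\<in>{0, 2}. patch y W c x) \<ge> exp (- 40) * exp (- D) * exp (- (norm x powr (2 - 2 * \<epsilon>)))"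
      if "norm x \<ge> R" for x
    proof -
      obtain c where c: "c \<in> {0, 2}" "exp (- 40) \<le> weight y c x" using good by blast
      have "exp (- 40) * (exp (- D) * exp (- (norm x powr (2 - 2 * \<epsilon>)))) \<le> weight y c x * norm (W c (cell y c x) x)"
        using c(2) size(1)[OF that, of c] weight_nonneg by (intro mult_mono) auto
      then show ?thesis using lower[OF c(1), of x] by (simp add: mult.assoc)
    qed
    show "(\<Sum>c\<in>{0, 2}. patch y W c x) \<noteq> 0" for x
    proof -
      obtain c where c: "c \<in> {0, 2}" "exp (- 40) \<le> weight y c x" "centred y c x" using good by blast
      then have "weight y c x * norm (W c (cell y c x) x) > 0"
        using nonzero[OF c(1,3)] by (intro mult_pos_pos) (auto intro: less_le_trans[OF exp_gt_zero])
      then show ?thesis using lower[OF c(1), of x] by auto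
    qed
  qed (use eps in \<open>auto simp: R_def\<close>)
qed

section \<open>Spinors in space\<close>

definition bloch :: "complex \<Rightarrow> complex \<Rightarrow> real^3"
  where "bloch a b = vector [2 * Re (cnj a * b), 2 * Im (cnj a * b), (cmod a)\<^sup>2 - (cmod b)\<^sup>2]"

lemma bloch_surj:
  assumes "norm (n :: real^3) = 1"
  obtains a b where "(cmod a)\<^sup>2 + (cmod b)\<^sup>2 = 1" "bloch a b = n"
proof -
  have n: "(n$1)\<^sup>2 + (n$2)\<^sup>2 + (n$3)\<^sup>2 = 1"
    using assms by (simp add: norm_vec_def L2_set_def sum_3)
  show thesis
  proof (cases "n$3 = - 1")
    case True
    then have "n$1 = 0" "n$2 = 0" using n by (auto simp: sum_power2_eq_zero_iff)
    then show thesis using True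
      by (intro that[of 0 1]) (auto simp: bloch_def vec_eq_iff forall_3)
  next
    case False
    have "(n$3)\<^sup>2 \<le> 1\<^sup>2" using n zero_le_power2[of "n$1"] zero_le_power2[of "n$2"]
      unfolding power_one by linarith
    then have pos: "1 + n$3 > 0" using False by (auto simp: abs_square_le_1)
    define r where "r = sqrt ((1 + n$3) / 2)"
    have r: "r > 0" "r\<^sup>2 = (1 + n$3) / 2" using pos by (auto simp: r_def)
    define a where "a = complex_of_real r"
    define b where "b = Complex (n$1 / (2 * r)) (n$2 / (2 * r))"
    have a: "(cmod a)\<^sup>2 = (1 + n$3) / 2" by (simp add: a_def r)
    have "(cmod b)\<^sup>2 = ((n$1)\<^sup>2 + (n$2)\<^sup>2) / (4 * r\<^sup>2)"
      by (simp add: b_def cmod_power2 power_divide power_mult_distrib add_divide_distrib)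
    also have "(n$1)\<^sup>2 + (n$2)\<^sup>2 = (1 - n$3) * (1 + n$3)"
      using n by (simp add: algebra_simps power2_eq_square)
    also have "\<dots> / (4 * r\<^sup>2) = (1 - n$3) / 2" using pos unfolding r(2) by (simp add: field_simps)
    finally have b: "(cmod b)\<^sup>2 = (1 - n$3) / 2" .
    have "cnj a * b = Complex (n$1 / 2) (n$2 / 2)"
      using r(1) by (simp add: a_def b_def complex_eq_iff)
    then have "bloch a b = n"
      by (simp add: bloch_def vec_eq_iff forall_3 a b field_simps)
    then show thesis using a b by (intro that[of a b]) auto
  qed
qed

lemma bloch_dist:
  assumes "(cmod a)\<^sup>2 + (cmod b)\<^sup>2 = 1" "(cmod a')\<^sup>2 + (cmod b')\<^sup>2 = 1"
  shows "2 * cmod (a * b' - b * a') = norm (bloch a b - bloch a' b')"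
proof -
  obtain a1 a2 b1 b2 a1' a2' b1' b2' where e: "a = Complex a1 a2" "b = Complex b1 b2"
    "a' = Complex a1' a2'" "b' = Complex b1' b2'" by (metis complex_surj)
  have 1: "a1\<^sup>2 + a2\<^sup>2 + (b1\<^sup>2 + b2\<^sup>2) = 1" "a1'\<^sup>2 + a2'\<^sup>2 + (b1'\<^sup>2 + b2'\<^sup>2) = 1"
    using assms by (simp_all add: e cmod_power2)
  have "(2 * cmod (a * b' - b * a'))\<^sup>2 = (norm (bloch a b - bloch a' b'))\<^sup>2"
    unfolding power_mult_distrib cmod_power2 
    apply (simp add: bloch_def e norm_vec_def L2_set_def sum_3 cmod_power2)
    using 1 by algebra
  then show ?thesis by (rule power2_eq_imp_eq) auto
qed

lemma two_spinors:
  assumes "(cmod a)\<^sup>2 + (cmod b)\<^sup>2 = 1" "(cmod a')\<^sup>2 + (cmod b')\<^sup>2 = 1"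
    and "w' = 0 \<or> norm (bloch a b - bloch a' b') \<ge> d"
  shows "min (d / 4) (1 / 2) * cmod w \<le> (cmod (w * a + w' * a') + cmod (w * b + w' * b')) / 2"
proof -
  have *: "r \<le> 1" if "r\<^sup>2 + t\<^sup>2 = 1" for r t :: real
  proof (rule power2_le_imp_le)
    show "r\<^sup>2 \<le> 1\<^sup>2" using that zero_le_power2[of t] unfolding power_one by linarith
  qed simp
  have le: "cmod a \<le> 1" "cmod b \<le> 1" "cmod a' \<le> 1" "cmod b' \<le> 1"
    using *[OF assms(1)] *[OF assms(2)] *[of "cmod b" "cmod a"] *[of "cmod b'" "cmod a'"] assms(1,2)
    by (simp_all add: add.commute)
  show ?thesis
  proof (cases "w' = 0")
    case True
    have "w = (w * a) * cnj a + (w * b) * cnj b"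
    proof -
      have "(w * a) * cnj a + (w * b) * cnj b = w * of_real ((cmod a)\<^sup>2 + (cmod b)\<^sup>2)"
        by (simp add: complex_norm_square algebra_simps del: of_real_power)
      then show ?thesis by (simp add: assms(1))
    qed
    then have "cmod w \<le> cmod ((w * a) * cnj a) + cmod ((w * b) * cnj b)"
      by (metis norm_triangle_ineq)
    also have "\<dots> \<le> cmod (w * a) * 1 + cmod (w * b) * 1"
      unfolding norm_mult[of _ "cnj _"] using le by (intro add_mono mult_left_mono) auto
    finally have *: "cmod w \<le> cmod (w * a) + cmod (w * b)" by simp
    have "min (d / 4) (1 / 2) * cmod w \<le> 1 / 2 * cmod w" by (intro mult_right_mono) auto
    then show ?thesis using * True by simp
  next
    case False
    then have "2 * cmod (a * b' - b * a') \<ge> d" using bloch_dist[OF assms(1,2)] assms(3) by simp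
    then have "d / 4 * cmod w \<le> cmod (a * b' - b * a') / 2 * cmod w" by (intro mult_right_mono) auto
    also have "\<dots> = cmod ((w * a + w' * a') * b' - (w * b + w' * b') * a') / 2"
      by (simp add: algebra_simps flip: norm_mult)
    also have "\<dots> \<le> (cmod (w * a + w' * a') * cmod b' + cmod (w * b + w' * b') * cmod a') / 2"
      by (intro divide_right_mono order.trans[OF norm_triangle_ineq4]) (auto simp: norm_mult)
    also have "\<dots> \<le> (cmod (w * a + w' * a') * 1 + cmod (w * b + w' * b') * 1) / 2"
      using le by (intro divide_right_mono add_mono mult_left_mono) auto
    finally have "d / 4 * cmod w \<le> (cmod (w * a + w' * a') + cmod (w * b + w' * b')) / 2" by simp
    moreover have "min (d / 4) (1 / 2) * cmod w \<le> d / 4 * cmod w" by (intro mult_right_mono) auto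
    ultimately show ?thesis by linarith
  qed
qed

lemma orthonormal_pair_exists:
  fixes q :: "real^3"
  obtains a b where "norm a = 1" "norm b = 1" "a \<bullet> b = 0" "a \<bullet> q = 0" "b \<bullet> q = 0"
proof -
  obtain a' where a': "a' \<noteq> 0" "orthogonal q a'"
    using orthogonal_to_vector_exists[of q] by auto
  obtain b' where b': "b' \<noteq> 0" "orthogonal a' b'" "orthogonal q b'"
  proof (cases "q = 0")
    case True
    then show thesis using orthogonal_to_vector_exists[of a'] that by (auto simp: orthogonal_def)
  next
    case False
    then have "cross3 a' q \<noteq> 0"
      using a' norm_cross_dot[of a' q] False by (auto simp: orthogonal_def inner_commute)
    then show thesis
      by (intro that[of "cross3 a' q"]) (auto simp: orthogonal_def dot_cross_self)
  qed
  show thesis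
    using a' b' by (intro that[of "sgn a'" "sgn b'"])
      (auto simp: norm_sgn sgn_div_norm orthogonal_def inner_commute)
qed

definition gap :: real
  where "gap = sqrt (2 - 2 * cos (pi / 9)) / 2"

lemma gap_pos: "gap > 0"
proof -
  have "cos (pi / 9) < cos 0" by (intro cos_monotone_0_pi) auto
  then show ?thesis by (simp add: gap_def)
qed

text \<open>Pigeonhole: nine unit vectors of the plane orthogonal to \<open>q\<close> are \<open>2 * gap\<close>-separated, so some
  vector is not \<open>gap\<close>-close to any of the at most eight elements of \<open>F\<close>.\<close>

lemma unit_normal_avoiding:
  fixes q :: "real^3" and F :: "(real^3) set"
  assumes "finite F" "card F \<le> 8"
  shows "\<exists>n. norm n = 1 \<and> n \<bullet> q = 0 \<and> (\<forall>m\<in>F. norm (n - m) \<ge> gap)"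
proof -
  obtain a b where ab: "norm a = 1" "norm b = 1" "a \<bullet> b = 0" "a \<bullet> q = 0" "b \<bullet> q = 0"
    by (rule orthonormal_pair_exists)
  define n where "n k = cos (real k * pi / 9) *\<^sub>R a + sin (real k * pi / 9) *\<^sub>R b" for k :: nat
  have inner: "a \<bullet> a = 1" "b \<bullet> b = 1" "a \<bullet> b = 0" "b \<bullet> a = 0"
    using ab by (auto simp: dot_square_norm inner_commute)
  have unit: "norm (n k) = 1" for k
    by (simp add: norm_eq_sqrt_inner n_def inner_add_left inner_add_right inner flip: power2_eq_square)
  have orth: "n k \<bullet> q = 0" for k using ab by (simp add: n_def inner_add_left)
  have dist: "norm (n k - n l) \<ge> 2 * gap" if "k < l" "l < 9" for k l
  proof -
    have "n k \<bullet> n l = cos (real l * pi / 9 - real k * pi / 9)"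
      by (simp add: n_def inner_add_left inner_add_right inner cos_diff ac_simps)
    also have "\<dots> \<le> cos (pi / 9)"
    proof (rule cos_monotone_0_pi_le)
      have "pi * 1 \<le> pi * (real l - real k)" using that by (intro mult_left_mono) auto
      then show "pi / 9 \<le> real l * pi / 9 - real k * pi / 9" by (simp add: algebra_simps)
      have "pi * (real l - real k) \<le> pi * 9" using that by (intro mult_left_mono) auto
      then show "real l * pi / 9 - real k * pi / 9 \<le> pi" by (simp add: algebra_simps)
    qed auto
    finally have "n k \<bullet> n l \<le> cos (pi / 9)" .
    then have "2 - 2 * cos (pi / 9) \<le> (norm (n k - n l))\<^sup>2"
      using unit[of k] unit[of l] dot_norm_neg[of "n k" "n l"] by simp
    then have "sqrt (2 - 2 * cos (pi / 9)) \<le> sqrt ((norm (n k - n l))\<^sup>2)"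
      by (rule real_sqrt_le_mono)
    then show ?thesis by (simp add: gap_def)
  qed
  have "\<exists>k<9. \<forall>m\<in>F. norm (n k - m) \<ge> gap"
  proof (rule ccontr)
    assume "\<not> (\<exists>k<9. \<forall>m\<in>F. norm (n k - m) \<ge> gap)"
    then have "\<forall>k. \<exists>m. k < 9 \<longrightarrow> m \<in> F \<and> norm (n k - m) < gap" by (meson not_le)
    then obtain f where f: "\<And>k. k < 9 \<Longrightarrow> f k \<in> F \<and> norm (n k - f k) < gap" by metis
    have "inj_on f {..<9}"
    proof (rule linorder_inj_onI)
      fix k l :: nat assume "k < l" "k \<in> {..<9}" "l \<in> {..<9}"
      then have "norm (n k - f k) < gap" "norm (n l - f l) < gap" "norm (n k - n l) \<ge> 2 * gap"
        using f dist by auto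
      moreover have "norm (n k - n l) \<le> norm (n k - f k) + norm (n l - f l)" if "f k = f l"
        using norm_triangle_ineq4[of "n k - f k" "n l - f l"] that by simp
      ultimately show "f k \<noteq> f l" by linarith
    qed auto
    then have "card {..<9 :: nat} \<le> card F"
      using f assms(1) by (intro card_inj_on_le[of f]) auto
    then show False using assms(2) by simp
  qed
  then show ?thesis using unit orth by blast
qed

text \<open>The cells of colour \<open>c\<close> that can meet the cell \<open>J\<close> of colour \<open>c + 1\<close>.\<close>

definition next_cells :: "(3 \<Rightarrow> int) \<Rightarrow> (3 \<Rightarrow> int) set"
  where "next_cells J = {J'. \<forall>i. J' i = J i \<or> J' i = J i + 1}"

lemma next_cells_card: "finite (next_cells J)" "card (next_cells J) \<le> 8"
proof -
  let ?f = "\<lambda>b i. J i + (if b i then 1 else 0)"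
  have sub: "next_cells J \<subseteq> range ?f"
  proof
    fix J' assume "J' \<in> next_cells J"
    then have "J' = ?f (\<lambda>i. J' i = J i + 1)" by (auto simp: next_cells_def fun_eq_iff)
    then show "J' \<in> range ?f" by (intro image_eqI[where x="\<lambda>i. J' i = J i + 1"]) auto
  qed
  then show "finite (next_cells J)" by (rule finite_subset) auto
  have "card (next_cells J) \<le> card (range ?f)" by (rule card_mono[OF _ sub]) auto
  also have "\<dots> \<le> card (UNIV :: (3 \<Rightarrow> bool) set)" by (rule card_image_le) auto
  also have "\<dots> = 8" by (simp add: card_fun)
  finally show "card (next_cells J) \<le> 8" .
qed

lemma cell_next: "cell y c x \<in> next_cells (cell y (Suc c) x)"
  unfolding next_cells_def cell_def mem_Collect_eq
proof
  fix i
  have "\<lfloor>s + 1 / 4\<rfloor> = \<lfloor>s\<rfloor> \<or> \<lfloor>s + 1 / 4\<rfloor> = \<lfloor>s\<rfloor> + 1" for s :: real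
    using floor_mono[of s "s + 1 / 4"] floor_mono[of "s + 1 / 4" "s + 1"] by auto
  from this[of "(y i x - real (Suc c)) / 4"]
  show "\<lfloor>(y i x - real c) / 4\<rfloor> = \<lfloor>(y i x - real (Suc c)) / 4\<rfloor> \<or>
      \<lfloor>(y i x - real c) / 4\<rfloor> = \<lfloor>(y i x - real (Suc c)) / 4\<rfloor> + 1"
    by (simp add: diff_divide_distrib add_divide_distrib)
qed

lemma spinor_field_exists:
  fixes q :: "nat \<Rightarrow> (3 \<Rightarrow> int) \<Rightarrow> real^3"
  obtains a b :: "nat \<Rightarrow> (3 \<Rightarrow> int) \<Rightarrow> complex"
  where "\<And>c J. (cmod (a c J))\<^sup>2 + (cmod (b c J))\<^sup>2 = 1" "\<And>c J. bloch (a c J) (b c J) \<bullet> q c J = 0"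
    "\<And>c J J'. even c \<Longrightarrow> J \<in> next_cells J' \<Longrightarrow>
      norm (bloch (a c J) (b c J) - bloch (a (Suc c) J') (b (Suc c) J')) \<ge> gap"
proof -
  have "\<forall>c J. \<exists>n. norm n = 1 \<and> n \<bullet> q c J = 0"
    using unit_normal_avoiding[of "{}"] by auto
  then obtain N where N: "\<And>c J. norm (N c J) = 1" "\<And>c J. N c J \<bullet> q c J = 0" by metis
  have "\<forall>c J. \<exists>n. norm n = 1 \<and> n \<bullet> q (Suc c) J = 0 \<and> (\<forall>m\<in>N c ` next_cells J. norm (n - m) \<ge> gap)"
    using next_cells_card by (intro allI unit_normal_avoiding)
      (auto intro: order.trans[OF card_image_le])
  then obtain N' where N': "\<And>c J. norm (N' c J) = 1" "\<And>c J. N' c J \<bullet> q (Suc c) J = 0"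
    "\<And>c J J'. J \<in> next_cells J' \<Longrightarrow> norm (N' c J' - N c J) \<ge> gap" by (metis imageI)
  define M where "M c J = (if even c then N c J else N' (c - 1) J)" for c J
  have M: "norm (M c J) = 1" "M c J \<bullet> q c J = 0" for c J
    using N N' N'(2)[of "c - 1" J] by (auto simp: M_def elim: oddE)
  have "\<forall>c J. \<exists>a b. (cmod a)\<^sup>2 + (cmod b)\<^sup>2 = 1 \<and> bloch a b = M c J"
    using bloch_surj M(1) by metis
  then obtain a b where ab: "\<And>c J. (cmod (a c J))\<^sup>2 + (cmod (b c J))\<^sup>2 = 1"
    "\<And>c J. bloch (a c J) (b c J) = M c J" by metis
  show thesis
  proof (rule that[of a b])
    show "norm (bloch (a c J) (b c J) - bloch (a (Suc c) J') (b (Suc c) J')) \<ge> gap"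
      if "even c" "J \<in> next_cells J'" for c J J'
      using N'(3)[OF that(2), of c] that(1) by (simp add: ab M_def norm_minus_commute)
  qed (use ab M in auto)
qed

section \<open>The spatial case\<close>

lemma vector_4 [simp]:
  "(vector [x, y, z, w] :: 'a::zero^4) $ 1 = x" "(vector [x, y, z, w] :: 'a^4) $ 2 = y"
  "(vector [x, y, z, w] :: 'a^4) $ 3 = z" "(vector [x, y, z, w] :: 'a^4) $ 4 = w"
  unfolding vector_def by simp_all

definition space_spinor :: "nat \<Rightarrow> complex \<Rightarrow> complex \<Rightarrow> complex^4"
  where "space_spinor c a b = (if c < 2 then vector [a, b, 0, 0] else vector [0, 0, a, b])"

lemma norm_space_spinor: "(norm (space_spinor c a b))\<^sup>2 = (cmod a)\<^sup>2 + (cmod b)\<^sup>2"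
  by (simp add: space_spinor_def norm_vec_def L2_set_def sum_4)

lemma bounded_linear_space_spinor: "bounded_linear (\<lambda>w. space_spinor c (w * a) (w * b))"
  by (intro linear_conv_bounded_linear[THEN iffD1] linearI)
    (auto simp: space_spinor_def vec_eq_iff forall_4 algebra_simps)

definition plane_wave :: "real \<Rightarrow> real^3 \<Rightarrow> real^3 \<Rightarrow> real^3 \<Rightarrow> real^3 \<Rightarrow> complex"
  where "plane_wave s q p n x = exp (Complex (- s - q \<bullet> (x - p)) (cross3 q n \<bullet> (x - p)))"

lemma norm_plane_wave: "norm (plane_wave s q p n x) = exp (- s - q \<bullet> (x - p))"
  by (simp add: plane_wave_def)

lemma C_class_on_plane_wave: "C_class_on k UNIV (plane_wave s q p n)"
proof -
  have lin: "C_class_on k UNIV (\<lambda>x. of_real (v \<bullet> (x - p)) :: complex)" for v :: "real^3"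
    by (rule C_class_on_of_real[OF open_UNIV C_class_on_linear_compose[OF bounded_linear_inner_right open_UNIV]])
      (intro C_class_on_diff C_class_on_ident C_class_on_const; simp)
  have "C_class_on k UNIV (\<lambda>x. exp (of_real (- s) - of_real (q \<bullet> (x - p)) + \<i> * of_real (cross3 q n \<bullet> (x - p))))"
    by (intro C_class_on_exp C_class_on_add C_class_on_diff C_class_on_mult C_class_on_const lin) auto
  then show ?thesis
    by (simp add: plane_wave_def[abs_def] Complex_eq)
qed

lemma plane_wave_has_derivative:
  "(plane_wave s q p n has_derivative
    (\<lambda>h. plane_wave s q p n x * Complex (- (q \<bullet> h)) (cross3 q n \<bullet> h))) (at x)"
proof -
  have "((\<lambda>x. Complex (- s - q \<bullet> (x - p)) (cross3 q n \<bullet> (x - p))) has_derivative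
      (\<lambda>h. Complex (- (q \<bullet> h)) (cross3 q n \<bullet> h))) (at x)"
    unfolding Complex_eq by (auto intro!: derivative_eq_intros)
  from has_derivative_compose[OF this DERIV_exp[unfolded has_field_derivative_def]]
  show ?thesis unfolding plane_wave_def .
qed

text \<open>The symbol of the Dirac operator at the isotropic vector \<open>- q + \<i> q \<times> n\<close> annihilates the spinor
  with Bloch vector \<open>n\<close>, because \<open>(\<sigma>\<cdot>q)(\<sigma>\<cdot>n) = q\<cdot>n + \<i> \<sigma>\<cdot>(q \<times> n)\<close> and \<open>\<sigma>\<cdot>n\<close> fixes this spinor.\<close>

lemma isotropic_symbol:
  assumes n: "bloch a b = n" "(cmod a)\<^sup>2 + (cmod b)\<^sup>2 = 1" "q \<bullet> n = 0"
  defines "\<zeta> \<equiv> \<lambda>j. Complex (- (q $ j)) (cross3 q n $ j)"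
  shows "\<zeta> 3 * a + (\<zeta> 1 - \<i> * \<zeta> 2) * b = 0" "(\<zeta> 1 + \<i> * \<zeta> 2) * a - \<zeta> 3 * b = 0"
proof -
  define n1 n2 n3 q1 q2 q3 :: complex
    where defs: "n1 = of_real (n $ 1)" "n2 = of_real (n $ 2)" "n3 = of_real (n $ 3)"
      "q1 = of_real (q $ 1)" "q2 = of_real (q $ 2)" "q3 = of_real (q $ 3)"
  have unit: "a * cnj a + b * cnj b = 1"
    using arg_cong[OF n(2), of complex_of_real] by (simp add: complex_norm_square del: of_real_power)
  have n3: "n3 = a * cnj a - b * cnj b"
    by (simp add: defs n(1)[symmetric] bloch_def complex_norm_square del: of_real_power)
  have n12: "n1 + \<i> * n2 = 2 * (cnj a * b)"
    by (simp add: defs n(1)[symmetric] bloch_def complex_eq_iff)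
  have n12': "n1 - \<i> * n2 = 2 * (a * cnj b)"
    by (simp add: defs n(1)[symmetric] bloch_def complex_eq_iff)
  have A: "n3 * a + (n1 - \<i> * n2) * b = a"
  proof -
    have "n3 * a + (n1 - \<i> * n2) * b = (a * cnj a + b * cnj b) * a"
      unfolding n3 n12' by (simp add: algebra_simps)
    then show ?thesis by (simp add: unit)
  qed
  have B: "(n1 + \<i> * n2) * a - n3 * b = b"
  proof -
    have "(n1 + \<i> * n2) * a - n3 * b = (a * cnj a + b * cnj b) * b"
      unfolding n3 n12 by (simp add: algebra_simps)
    then show ?thesis by (simp add: unit)
  qed
  have "complex_of_real (q $ 1 * n $ 1 + q $ 2 * n $ 2 + q $ 3 * n $ 3) = 0"
    using n(3) by (simp add: inner_vec_def sum_3)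
  then have qn: "q1 * n1 + q2 * n2 + q3 * n3 = 0" by (simp add: defs)
  have z: "\<zeta> 1 = - q1 + \<i> * (q2 * n3 - q3 * n2)" "\<zeta> 2 = - q2 + \<i> * (q3 * n1 - q1 * n3)"
    "\<zeta> 3 = - q3 + \<i> * (q1 * n2 - q2 * n1)"
    by (simp_all add: \<zeta>_def defs cross3_def complex_eq_iff)
  have "\<zeta> 3 * a + (\<zeta> 1 - \<i> * \<zeta> 2) * b =
      q3 * (n3 * a + (n1 - \<i> * n2) * b - a) + (q1 - \<i> * q2) * ((n1 + \<i> * n2) * a - n3 * b - b)
      - (q1 * n1 + q2 * n2 + q3 * n3) * a"
    unfolding z by (simp add: algebra_simps)
  then show "\<zeta> 3 * a + (\<zeta> 1 - \<i> * \<zeta> 2) * b = 0" using A B qn by simp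
  have "(\<zeta> 1 + \<i> * \<zeta> 2) * a - \<zeta> 3 * b =
      (q1 + \<i> * q2) * (n3 * a + (n1 - \<i> * n2) * b - a) - q3 * ((n1 + \<i> * n2) * a - n3 * b - b)
      - (q1 * n1 + q2 * n2 + q3 * n3) * b"
    unfolding z by (simp add: algebra_simps)
  then show "(\<zeta> 1 + \<i> * \<zeta> 2) * a - \<zeta> 3 * b = 0" using A B qn by simp
qed

lemma dirac_plane_wave:
  assumes "(cmod a)\<^sup>2 + (cmod b)\<^sup>2 = 1" "bloch a b \<bullet> q = 0"
  shows "dirac alpha3 (\<lambda>x. space_spinor c (plane_wave s q p (bloch a b) x * a)
    (plane_wave s q p (bloch a b) x * b)) x = 0"
proof -
  let ?E = "plane_wave s q p (bloch a b)"
  define \<zeta> where "\<zeta> = (\<lambda>j. Complex (- (q $ j)) (cross3 q (bloch a b) $ j))"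
  have "((\<lambda>x. space_spinor c (?E x * a) (?E x * b)) has_derivative
      (\<lambda>h. space_spinor c (?E x * Complex (- (q \<bullet> h)) (cross3 q (bloch a b) \<bullet> h) * a)
        (?E x * Complex (- (q \<bullet> h)) (cross3 q (bloch a b) \<bullet> h) * b))) (at x)"
    by (rule bounded_linear.has_derivative[OF bounded_linear_space_spinor plane_wave_has_derivative])
  from partial_eqI[OF this]
  have p: "partial j (\<lambda>x. space_spinor c (?E x * a) (?E x * b)) x =
      space_spinor c (?E x * \<zeta> j * a) (?E x * \<zeta> j * b)" for j
    by (simp add: \<zeta>_def inner_axis)
  have "q \<bullet> bloch a b = 0" using assms(2) by (simp add: inner_commute)
  then have iso: "\<zeta> 3 * a + (\<zeta> 1 - \<i> * \<zeta> 2) * b = 0" "(\<zeta> 1 + \<i> * \<zeta> 2) * a - \<zeta> 3 * b = 0"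
    unfolding \<zeta>_def by (rule isotropic_symbol[OF refl assms(1)])+
  have "?E x * \<zeta> 1 * b - \<i> * (?E x * \<zeta> 2 * b) + ?E x * \<zeta> 3 * a = ?E x * (\<zeta> 3 * a + (\<zeta> 1 - \<i> * \<zeta> 2) * b)"
    "?E x * \<zeta> 1 * a + \<i> * (?E x * \<zeta> 2 * a) - ?E x * \<zeta> 3 * b = ?E x * ((\<zeta> 1 + \<i> * \<zeta> 2) * a - \<zeta> 3 * b)"
    by (simp_all add: algebra_simps)
  then have "?E x * \<zeta> 1 * b - \<i> * (?E x * \<zeta> 2 * b) + ?E x * \<zeta> 3 * a = 0"
    "?E x * \<zeta> 1 * a + \<i> * (?E x * \<zeta> 2 * a) - ?E x * \<zeta> 3 * b = 0"
    by (simp_all only: iso mult_zero_right)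
  then have "(\<Sum>j\<in>UNIV. alpha3 $ j *v space_spinor c (?E x * \<zeta> j * a) (?E x * \<zeta> j * b)) = 0"
    unfolding sum_3
    by (simp add: alpha3_def off_diag_def pauli1_def pauli2_def pauli3_def space_spinor_def
        vec_eq_iff forall_4 matrix_vector_mult_def sum_4)
  then show ?thesis unfolding dirac_def p by simp
qed

lemma powr_quadratic_bound:
  fixes \<kappa> \<beta> :: real
  assumes "\<beta> * (\<kappa> + 1) = 2"
  obtains C :: real where "C > 0"
    "\<And>t. t \<in> {1/2..2} \<Longrightarrow> \<bar>t\<^sup>2 - 1 - \<beta> * (t powr \<kappa> * (t\<^sup>2 + 1) / 2 - 1)\<bar> \<le> C * (t - 1)\<^sup>2"
proof (rule quadratic_bound[where G="\<lambda>t. t\<^sup>2 - 1 - \<beta> * (t powr \<kappa> * (t\<^sup>2 + 1) / 2 - 1)"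
      and G'="\<lambda>t. 2 * t - \<beta> * (\<kappa> * t powr (\<kappa> - 1) * (t\<^sup>2 + 1) / 2 + t powr \<kappa> * t)"
      and G''="\<lambda>t. 2 - \<beta> * (\<kappa> * (\<kappa> - 1) * t powr (\<kappa> - 2) * (t\<^sup>2 + 1) / 2 + 2 * \<kappa> * t powr (\<kappa> - 1) * t + t powr \<kappa>)"])
  let ?G' = "\<lambda>t. 2 * t - \<beta> * (\<kappa> * t powr (\<kappa> - 1) * (t\<^sup>2 + 1) / 2 + t powr \<kappa> * t)"
  show "continuous_on {1/2..2} (\<lambda>t. 2 - \<beta> * (\<kappa> * (\<kappa> - 1) * t powr (\<kappa> - 2) * (t\<^sup>2 + 1) / 2 + 2 * \<kappa> * t powr (\<kappa> - 1) * t + t powr \<kappa>))"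
    by (intro continuous_intros) auto
  show "((\<lambda>t. t\<^sup>2 - 1 - \<beta> * (t powr \<kappa> * (t\<^sup>2 + 1) / 2 - 1)) has_real_derivative ?G' t) (at t)"
    if "t \<in> {1/2..2}" for t
  proof -
    have "t > 0" using that by simp
    then show ?thesis by (auto intro!: derivative_eq_intros has_real_derivative_powr simp: field_simps)
  qed
  show "(?G' has_real_derivative 2 - \<beta> * (\<kappa> * (\<kappa> - 1) * t powr (\<kappa> - 2) * (t\<^sup>2 + 1) / 2 + 2 * \<kappa> * t powr (\<kappa> - 1) * t + t powr \<kappa>)) (at t)"
    if "t \<in> {1/2..2}" for t
  proof -
    have "t > 0" using that by simp
    then show ?thesis
      by (auto intro!: derivative_eq_intros has_real_derivative_powr simp: field_simps)
  qed
  show "?G' 1 = 0" using assms by (simp add: algebra_simps)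
qed (auto intro: that)

text \<open>With \<open>p = |Z| powr (\<epsilon> / (1 - \<epsilon>)) * Z\<close>, the vector paired with \<open>x - p\<close> is the gradient of
  \<open>|x| powr (2 - 2 * \<epsilon>)\<close> at \<open>p\<close>, so the bounded quantity is a first-order Taylor remainder. It is
  estimated in the coordinate \<open>Y = |x| powr (- \<epsilon>) * x\<close>, in which the function is \<open>|Y|\<^sup>2\<close> and \<open>p\<close> is \<open>Z\<close>.\<close>

lemma taylor_remainder_bound:
  fixes \<epsilon> :: real
  assumes eps: "\<epsilon> < 1"
  obtains D :: real where "\<And>x Z :: real^3. x \<noteq> 0 \<Longrightarrow> norm x powr (1 - \<epsilon>) \<ge> 8 \<Longrightarrow>
    norm (norm x powr (- \<epsilon>) *\<^sub>R x - Z) \<le> 4 \<Longrightarrow>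
    \<bar>norm x powr (2 - 2 * \<epsilon>) - (norm Z)\<^sup>2 -
      (2 * (1 - \<epsilon>) * norm Z powr (- (\<epsilon> / (1 - \<epsilon>)))) *\<^sub>R Z \<bullet> (x - norm Z powr (\<epsilon> / (1 - \<epsilon>)) *\<^sub>R Z)\<bar> \<le> D"
proof -
  define \<kappa> \<beta> where "\<kappa> = \<epsilon> / (1 - \<epsilon>)" and "\<beta> = 2 * (1 - \<epsilon>)"
  have \<beta>: "\<beta> * (\<kappa> + 1) = 2" "\<beta> \<ge> 0" using eps by (auto simp: \<kappa>_def \<beta>_def field_simps)
  obtain C :: real where C: "C > 0"
    "\<And>t. t \<in> {1/2..2} \<Longrightarrow> \<bar>t\<^sup>2 - 1 - \<beta> * (t powr \<kappa> * (t\<^sup>2 + 1) / 2 - 1)\<bar> \<le> C * (t - 1)\<^sup>2"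
    using powr_quadratic_bound[OF \<beta>(1)] by blast
  have "bounded ((\<lambda>t. t powr \<kappa>) ` {1/2..2 :: real})"
    by (intro compact_imp_bounded compact_continuous_image continuous_intros) auto
  then obtain B where B: "\<And>t. t \<in> {1/2..2} \<Longrightarrow> t powr \<kappa> \<le> B"
    by (fastforce simp: bounded_real)
  show thesis
  proof (rule that[of "16 * C + \<beta> * B * 8"])
    fix x Z :: "real^3"
    define Y where "Y = norm x powr (- \<epsilon>) *\<^sub>R x"
    define t s where "t = norm Y" and "s = norm Z"
    assume x: "x \<noteq> 0" and "norm x powr (1 - \<epsilon>) \<ge> 8" and "norm (norm x powr (- \<epsilon>) *\<^sub>R x - Z) \<le> 4"
    then have YZ: "norm (Y - Z) \<le> 4" by (simp add: Y_def)
    have "norm x powr (- \<epsilon>) * norm x powr 1 = norm x powr (1 - \<epsilon>)"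
      unfolding powr_add[symmetric] by simp
    then have tx: "t = norm x powr (1 - \<epsilon>)" using x by (simp add: t_def Y_def)
    then have t: "t \<ge> 8" using \<open>norm x powr (1 - \<epsilon>) \<ge> 8\<close> by simp
    have ts: "\<bar>t - s\<bar> \<le> norm (Y - Z)" unfolding t_def s_def by (rule norm_triangle_ineq3)
    have s: "s \<ge> 4" "t / s \<in> {1/2..2}" using near_ratio[OF t, of s] ts YZ by auto
    have t2: "norm x powr (2 - 2 * \<epsilon>) = t\<^sup>2"
      using x by (simp add: tx powr_powr flip: powr_numeral) (simp add: algebra_simps)
    have "t powr \<kappa> = norm x powr \<epsilon>" using eps by (simp add: tx powr_powr \<kappa>_def)
    then have xY: "x = t powr \<kappa> *\<^sub>R Y" using x by (simp add: Y_def powr_minus)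
    have ip: "Z \<bullet> Y = (t\<^sup>2 + s\<^sup>2 - (norm (Y - Z))\<^sup>2) / 2"
      unfolding t_def s_def by (subst inner_commute) (rule dot_norm_neg)
    have ratio: "s powr (- \<kappa>) * t powr \<kappa> = (t / s) powr \<kappa>"
      using s t by (simp add: powr_divide powr_minus field_simps)
    have one: "s powr (- \<kappa>) * s powr \<kappa> = 1" using s by (simp add: powr_minus)
    have "(\<beta> * s powr (- \<kappa>)) *\<^sub>R Z \<bullet> (x - s powr \<kappa> *\<^sub>R Z) =
        \<beta> * (s powr (- \<kappa>) * t powr \<kappa>) * (Z \<bullet> Y) - \<beta> * (s powr (- \<kappa>) * s powr \<kappa>) * s\<^sup>2"
      by (subst xY) (simp add: inner_diff_right s_def power2_norm_eq_inner algebra_simps)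
    also have "\<dots> = \<beta> * (t / s) powr \<kappa> * ((t\<^sup>2 + s\<^sup>2 - (norm (Y - Z))\<^sup>2) / 2) - \<beta> * s\<^sup>2"
      unfolding ratio one ip by simp
    finally have q: "(\<beta> * s powr (- \<kappa>)) *\<^sub>R Z \<bullet> (x - s powr \<kappa> *\<^sub>R Z) =
      \<beta> * (t / s) powr \<kappa> * ((t\<^sup>2 + s\<^sup>2 - (norm (Y - Z))\<^sup>2) / 2) - \<beta> * s\<^sup>2" .
    define r where "r = t / s"
    have tr: "t = r * s" using s by (simp add: r_def)
    have "t\<^sup>2 - s\<^sup>2 - (\<beta> * r powr \<kappa> * ((t\<^sup>2 + s\<^sup>2 - (norm (Y - Z))\<^sup>2) / 2) - \<beta> * s\<^sup>2) =
      s\<^sup>2 * (r\<^sup>2 - 1 - \<beta> * (r powr \<kappa> * (r\<^sup>2 + 1) / 2 - 1)) + \<beta> * r powr \<kappa> * ((norm (Y - Z))\<^sup>2 / 2)"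
      unfolding tr by (simp add: field_simps power2_eq_square)
    moreover have "\<bar>s\<^sup>2 * (r\<^sup>2 - 1 - \<beta> * (r powr \<kappa> * (r\<^sup>2 + 1) / 2 - 1))\<bar> \<le> 16 * C"
    proof -
      have "\<bar>s\<^sup>2 * (r\<^sup>2 - 1 - \<beta> * (r powr \<kappa> * (r\<^sup>2 + 1) / 2 - 1))\<bar> \<le> s\<^sup>2 * (C * (r - 1)\<^sup>2)"
        unfolding abs_mult using C(2) s(2) by (intro mult_mono) (auto simp: r_def)
      also have "\<dots> = C * (t - s)\<^sup>2"
        unfolding tr by (simp add: power2_eq_square algebra_simps)
      also have "\<dots> \<le> C * 4\<^sup>2"
        using ts YZ C(1) abs_le_square_iff[of "t - s" 4] by (intro mult_left_mono) auto
      finally show ?thesis by simp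
    qed
    moreover have "\<bar>\<beta> * r powr \<kappa> * ((norm (Y - Z))\<^sup>2 / 2)\<bar> \<le> \<beta> * B * 8"
    proof -
      have "(norm (Y - Z))\<^sup>2 \<le> 4\<^sup>2" using YZ by (intro power_mono) auto
      then have "\<beta> * r powr \<kappa> * ((norm (Y - Z))\<^sup>2 / 2) \<le> \<beta> * B * 8"
        using B[OF s(2)] \<beta>(2) order.trans[OF powr_ge_zero B[OF s(2)]]
        by (intro mult_mono) (auto simp: r_def)
      then show ?thesis using \<beta>(2) by simp
    qed
    ultimately show "\<bar>norm x powr (2 - 2 * \<epsilon>) - (norm Z)\<^sup>2 -
      (2 * (1 - \<epsilon>) * norm Z powr (- (\<epsilon> / (1 - \<epsilon>)))) *\<^sub>R Z \<bullet> (x - norm Z powr (\<epsilon> / (1 - \<epsilon>)) *\<^sub>R Z)\<bar>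
        \<le> 16 * C + \<beta> * B * 8"
      unfolding t2 \<kappa>_def[symmetric] \<beta>_def[symmetric] s_def[symmetric] q r_def[symmetric] by linarith
  qed
qed

definition space_centre :: "nat \<Rightarrow> (3 \<Rightarrow> int) \<Rightarrow> real^3"
  where "space_centre c J = (\<chi> i. cell_centre c (J i))"

theorem space_case:
  fixes \<epsilon> :: real
  assumes eps: "\<epsilon> < 1"
  shows "\<exists>(u :: real^3 \<Rightarrow> complex^4) (V :: real^3 \<Rightarrow> complex^4^4).
    smooth u \<and> smooth V \<and> (\<exists>x. u x \<noteq> 0) \<and> (\<exists>x. V x \<noteq> 0) \<and>
    (\<exists>C1>0. \<exists>C2>0. \<exists>C3>0. \<forall>x. dirac alpha3 u x = V x *v u x \<and>
      norm (u x) \<le> C1 * exp (- C2 * norm x powr (2 - 2 * \<epsilon>)) \<and>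
      (norm x < 2 \<longrightarrow> V x = 0) \<and> norm (V x) \<le> C3 * norm x powr (- \<epsilon>))"
proof -
  define q where "q c J = (2 * (1 - \<epsilon>) * norm (space_centre c J) powr (- (\<epsilon> / (1 - \<epsilon>)))) *\<^sub>R space_centre c J" for c J
  define p where "p c J = norm (space_centre c J) powr (\<epsilon> / (1 - \<epsilon>)) *\<^sub>R space_centre c J" for c J
  obtain D where D: "\<And>x c J. x \<noteq> 0 \<Longrightarrow> norm x powr (1 - \<epsilon>) \<ge> 8 \<Longrightarrow>
    norm (norm x powr (- \<epsilon>) *\<^sub>R x - space_centre c J) \<le> 4 \<Longrightarrow>
    \<bar>norm x powr (2 - 2 * \<epsilon>) - (norm (space_centre c J))\<^sup>2 - q c J \<bullet> (x - p c J)\<bar> \<le> D"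
    using taylor_remainder_bound[OF eps] unfolding q_def p_def by metis
  obtain a b where ab: "\<And>c J. (cmod (a c J))\<^sup>2 + (cmod (b c J))\<^sup>2 = 1"
    "\<And>c J. bloch (a c J) (b c J) \<bullet> q c J = 0"
    "\<And>c J J'. even c \<Longrightarrow> J \<in> next_cells J' \<Longrightarrow>
      norm (bloch (a c J) (b c J) - bloch (a (Suc c) J') (b (Suc c) J')) \<ge> gap"
    using spinor_field_exists[of q] by blast
  define y :: "3 \<Rightarrow> real^3 \<Rightarrow> real" where "y = (\<lambda>i x. cut_powr (- \<epsilon>) x * x $ i)"
  define E where "E c J = plane_wave ((norm (space_centre c J))\<^sup>2) (q c J) (p c J) (bloch (a c J) (b c J))" for c J
  define W :: "nat \<Rightarrow> (3 \<Rightarrow> int) \<Rightarrow> real^3 \<Rightarrow> complex^4"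
    where "W = (\<lambda>c J x. space_spinor c (E c J x * a c J) (E c J x * b c J))"
  define R where "R = max 3 (8 powr (1 / (1 - \<epsilon>)))"
  let ?X = "\<lambda>x :: real^3. exp (- (norm x powr (2 - 2 * \<epsilon>)))"
  have normW: "norm (W c J x) = norm (E c J x)" for c J x
  proof -
    have "(norm (W c J x))\<^sup>2 = (norm (E c J x))\<^sup>2 * ((cmod (a c J))\<^sup>2 + (cmod (b c J))\<^sup>2)"
      by (simp add: W_def norm_space_spinor norm_mult power_mult_distrib algebra_simps)
    then show ?thesis by (simp add: ab(1) power2_eq_iff_nonneg)
  qed
  have size: "norm (E c (cell y c x) x) \<ge> exp (- D) * ?X x" "norm (E c (cell y c x) x) \<le> exp D * ?X x"
    if x: "norm x \<ge> R" for c x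
  proof -
    have 3: "norm x \<ge> 3" using x by (simp add: R_def)
    have "(8 powr (1 / (1 - \<epsilon>))) powr (1 - \<epsilon>) \<le> norm x powr (1 - \<epsilon>)"
      using eps x by (intro powr_mono2) (auto simp: R_def)
    then have 8: "norm x powr (1 - \<epsilon>) \<ge> 8" using eps by (simp add: powr_powr)
    let ?v = "norm x powr (- \<epsilon>) *\<^sub>R x - space_centre c (cell y c x)"
    have "\<bar>?v $ i\<bar> \<le> 2" for i
      using cell_centre_dist[of y i x c] 3 by (simp add: y_def cut_powr_far space_centre_def)
    then have "(?v $ i)\<^sup>2 \<le> 4" for i using abs_le_square_iff[of "?v $ i" 2] by simp
    then have "(norm ?v)\<^sup>2 \<le> 4 + 4 + 4"
      unfolding power2_norm_eq_inner inner_vec_def sum_3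
      by (intro add_mono) (simp_all add: power2_eq_square)
    then have "(norm ?v)\<^sup>2 \<le> 4\<^sup>2" by simp
    then have "norm ?v \<le> 4" by (rule power2_le_imp_le) simp
    from D[OF _ 8 this] 3
    have d: "\<bar>norm x powr (2 - 2 * \<epsilon>) - (norm (space_centre c (cell y c x)))\<^sup>2 -
      q c (cell y c x) \<bullet> (x - p c (cell y c x))\<bar> \<le> D" by force
    have *: "- D + - t \<le> - s - r \<and> - s - r \<le> D + - t" if "\<bar>t - s - r\<bar> \<le> D" for t s r :: real
      using that by linarith
    show "norm (E c (cell y c x) x) \<ge> exp (- D) * ?X x" "norm (E c (cell y c x) x) \<le> exp D * ?X x"
      unfolding E_def norm_plane_wave exp_add[symmetric] exp_le_cancel_iff using *[OF d] by blast+
  qed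
  define \<delta> where "\<delta> = min (gap / 4) (1 / 2)"
  have \<delta>: "\<delta> > 0" using gap_pos by (simp add: \<delta>_def)
  have lower: "norm (\<Sum>c\<in>{0, 1, 2, 3}. patch y W c x) \<ge> \<delta> * (weight y c x * norm (E c (cell y c x) x))"
    if c: "c \<in> {0, 1, 2, 3}" "centred y c x" for c x
  proof -
    define A B w where "A c = a c (cell y c x)" and "B c = b c (cell y c x)"
      and "w c = complex_of_real (weight y c x) * E c (cell y c x) x" for c
    let ?u = "\<Sum>c\<in>{0, 1, 2, 3}. patch y W c x"
    have u: "?u = vector [w 0 * A 0 + w 1 * A 1, w 0 * B 0 + w 1 * B 1,
        w 2 * A 2 + w 3 * A 3, w 2 * B 2 + w 3 * B 3]"
      by (simp add: patch_def W_def w_def A_def B_def space_spinor_def vec_eq_iff forall_4 scaleR_conv_of_real[where 'a=complex] mult.assoc)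
    have pair: "\<delta> * cmod (w c) \<le> (cmod (w c * A c + w (Suc c) * A (Suc c)) + cmod (w c * B c + w (Suc c) * B (Suc c))) / 2"
      "\<delta> * cmod (w (Suc c)) \<le> (cmod (w c * A c + w (Suc c) * A (Suc c)) + cmod (w c * B c + w (Suc c) * B (Suc c))) / 2"
      if "even c" for c
    proof -
      have g: "gap \<le> norm (bloch (A c) (B c) - bloch (A (Suc c)) (B (Suc c)))"
        unfolding A_def B_def by (rule ab(3)[OF that cell_next])
      show "\<delta> * cmod (w c) \<le> (cmod (w c * A c + w (Suc c) * A (Suc c)) + cmod (w c * B c + w (Suc c) * B (Suc c))) / 2"
        unfolding \<delta>_def using g by (intro two_spinors) (auto simp: A_def B_def ab(1))
      have "\<delta> * cmod (w (Suc c)) \<le> (cmod (w (Suc c) * A (Suc c) + w c * A c) + cmod (w (Suc c) * B (Suc c) + w c * B c)) / 2"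
        unfolding \<delta>_def using g by (intro two_spinors) (auto simp: A_def B_def ab(1) norm_minus_commute)
      then show "\<delta> * cmod (w (Suc c)) \<le> (cmod (w c * A c + w (Suc c) * A (Suc c)) + cmod (w c * B c + w (Suc c) * B (Suc c))) / 2"
        by (simp add: add.commute)
    qed
    have le: "cmod (w 0 * A 0 + w 1 * A 1) \<le> norm ?u" "cmod (w 0 * B 0 + w 1 * B 1) \<le> norm ?u"
      "cmod (w 2 * A 2 + w 3 * A 3) \<le> norm ?u" "cmod (w 2 * B 2 + w 3 * B 3) \<le> norm ?u"
      using Finite_Cartesian_Product.norm_nth_le[of ?u 1] Finite_Cartesian_Product.norm_nth_le[of ?u 2]
        Finite_Cartesian_Product.norm_nth_le[of ?u 3] Finite_Cartesian_Product.norm_nth_le[of ?u 4]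
      unfolding u by simp_all
    have "\<delta> * cmod (w c) \<le> norm ?u"
      using c(1) pair[of 0] pair[of 2] le by (auto simp: numeral_3_eq_3 numeral_2_eq_2)
    then show ?thesis by (simp add: w_def norm_mult weight_nonneg)
  qed
  have good: "\<exists>c\<in>{0, 1, 2, 3}. exp (- 40) ^ 3 \<le> weight y c x \<and> centred y c x" for x
  proof -
    obtain c where c: "c \<in> {0, 1, 2, 3 :: nat}" "\<And>i. cos (pi / 2 * (y i x - real c)) \<le> 3 / 4"
      by (rule good_colour[of "{0, 1, 2, 3 :: nat}" y x]) auto
    then show ?thesis using weight_lower[of y x c] by auto
  qed
  let ?K = "max (exp D) (1 + \<bar>\<epsilon>\<bar>)"
  show ?thesis
  proof (rule patchwork[where I="{0, 1, 2, 3}" and y=y and W=W and R=R and K="?K" and k="\<delta> * (exp (- 40) ^ 3 * exp (- D))"])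
    have nth: "C_class_on k UNIV (\<lambda>x :: real^3. x $ i)" for k i
      by (rule C_class_on_linear_compose[OF bounded_linear_vec_nth open_UNIV C_class_on_ident[OF open_UNIV]])
    then show "C_class_on k UNIV (y i)" for k i
      unfolding y_def by (intro C_class_on_mult C_class_on_cut_powr) auto
    show "y i x = 0" if "norm x < 2" for i x using that by (simp add: y_def cut_powr_near)
    show "\<bar>partial j (y i) x\<bar> \<le> ?K * norm x powr (- \<epsilon>)" if "norm x \<ge> R" for i j x
    proof -
      have 3: "norm x \<ge> 3" using that by (simp add: R_def)
      have "partial j (\<lambda>x :: real^3. x $ i) x = axis j 1 $ i"
        by (rule partial_eqI[OF bounded_linear_imp_has_derivative[OF bounded_linear_vec_nth]])
      then have "partial j (y i) x = cut_powr (- \<epsilon>) x * axis j 1 $ i + partial j (cut_powr (- \<epsilon>)) x * x $ i"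
        unfolding y_def using C_class_on_cut_powr[of "Suc 0" "- \<epsilon>"] nth[of "Suc 0" i] by (subst partial_mult) auto
      then have "\<bar>partial j (y i) x\<bar> \<le> \<bar>cut_powr (- \<epsilon>) x * axis j 1 $ i\<bar> + \<bar>partial j (cut_powr (- \<epsilon>)) x * x $ i\<bar>"
        by simp
      also have "\<bar>cut_powr (- \<epsilon>) x * axis j 1 $ i\<bar> \<le> norm x powr (- \<epsilon>)"
        using 3 by (simp add: cut_powr_far axis_def)
      also have "\<bar>partial j (cut_powr (- \<epsilon>)) x * x $ i\<bar> \<le> \<bar>- \<epsilon>\<bar> * norm x powr (- \<epsilon> - 1) * norm x"
        unfolding abs_mult by (intro mult_mono partial_cut_powr_bound 3 component_le_norm_cart) auto
      also have "\<dots> = \<bar>\<epsilon>\<bar> * norm x powr (- \<epsilon>)"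
      proof -
        have "norm x powr (- \<epsilon> - 1) * norm x powr 1 = norm x powr (- \<epsilon>)"
          unfolding powr_add[symmetric] by simp
        then show ?thesis using 3 by simp
      qed
      also have "norm x powr (- \<epsilon>) + \<bar>\<epsilon>\<bar> * norm x powr (- \<epsilon>) = (1 + \<bar>\<epsilon>\<bar>) * norm x powr (- \<epsilon>)"
        by (simp add: algebra_simps)
      also have "\<dots> \<le> ?K * norm x powr (- \<epsilon>)" by (intro mult_right_mono) auto
      finally show ?thesis by simp
    qed
    show "\<exists>S. open S \<and> x \<in> S \<and> (\<forall>k. C_class_on k S (W c (cell y c x)))" for c x
    proof (intro exI[of _ UNIV] conjI allI)
      show "C_class_on k UNIV (W c (cell y c x))" for k
        unfolding W_def E_def
        by (rule C_class_on_linear_compose[OF bounded_linear_space_spinor open_UNIV C_class_on_plane_wave])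
    qed auto
    show "dirac alpha3 (W c (cell y c x)) x = 0" for c x
      unfolding W_def E_def by (rule dirac_plane_wave[OF ab(1,2)])
    show "norm (W c (cell y c x) x) \<le> ?K * ?X x" if "norm x \<ge> R" for c x
      unfolding normW by (rule order.trans[OF size(2)[OF that]]) (intro mult_right_mono; simp)
    show "norm (\<Sum>c\<in>{0, 1, 2, 3}. patch y W c x) \<ge> \<delta> * (exp (- 40) ^ 3 * exp (- D)) * ?X x"
      if "norm x \<ge> R" for x
    proof -
      obtain c where c: "c \<in> {0, 1, 2, 3}" "exp (- 40) ^ 3 \<le> weight y c x" "centred y c x" using good by blast
      have "exp (- 40) ^ 3 * (exp (- D) * ?X x) \<le> weight y c x * norm (E c (cell y c x) x)"
        using c(2) size(1)[OF that, of c] weight_nonneg by (intro mult_mono) auto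
      then have "\<delta> * (exp (- 40) ^ 3 * (exp (- D) * ?X x)) \<le> \<delta> * (weight y c x * norm (E c (cell y c x) x))"
        using \<delta> by (intro mult_left_mono) auto
      then show ?thesis using lower[OF c(1,3)] by (simp add: mult.assoc)
    qed
    show "(\<Sum>c\<in>{0, 1, 2, 3}. patch y W c x) \<noteq> 0" for x
    proof -
      obtain c where c: "c \<in> {0, 1, 2, 3}" "exp (- 40) ^ 3 \<le> weight y c x" "centred y c x" using good by blast
      have "weight y c x > 0" by (rule less_le_trans[OF _ c(2)]) simp
      then have "\<delta> * (weight y c x * norm (E c (cell y c x) x)) > 0"
        using \<delta> by (intro mult_pos_pos) (auto simp: E_def norm_plane_wave)
      then show ?thesis using lower[OF c(1,3)] by auto
    qed
  qed (use eps \<delta> in \<open>auto simp: R_def\<close>)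
qed

theorem theorem1p6:
  fixes \<epsilon> :: real
  assumes "\<epsilon> < 1"
  shows
    "(\<exists>(u :: real^2 \<Rightarrow> complex^2) (V :: real^2 \<Rightarrow> complex^2^2).
        smooth u \<and> smooth V \<and> (\<exists>x. u x \<noteq> 0) \<and> (\<exists>x. V x \<noteq> 0) \<and>
        (\<exists>C1>0. \<exists>C2>0. \<exists>C3>0. \<forall>x.
           dirac alpha2 u x = V x *v u x \<and>
           norm (u x) \<le> C1 * exp (- C2 * norm x powr (2 - 2 * \<epsilon>)) \<and>
           (x \<noteq> 0 \<longrightarrow> norm (V x) \<le> C3 * norm x powr (- \<epsilon>)))) \<and>
     (\<exists>(u :: real^3 \<Rightarrow> complex^4) (V :: real^3 \<Rightarrow> complex^4^4).
        smooth u \<and> smooth V \<and> (\<exists>x. u x \<noteq> 0) \<and> (\<exists>x. V x \<noteq> 0) \<and>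
        (\<exists>C1>0. \<exists>C2>0. \<exists>C3>0. \<forall>x.
           dirac alpha3 u x = V x *v u x \<and>
           norm (u x) \<le> C1 * exp (- C2 * norm x powr (2 - 2 * \<epsilon>)) \<and>
           (x \<noteq> 0 \<longrightarrow>
              norm (V x) \<le> C3 * norm x powr (- \<epsilon>) * \<bar>ln (norm x)\<bar> ^ 3)))"
proof
  show "\<exists>(u :: real^2 \<Rightarrow> complex^2) (V :: real^2 \<Rightarrow> complex^2^2).
        smooth u \<and> smooth V \<and> (\<exists>x. u x \<noteq> 0) \<and> (\<exists>x. V x \<noteq> 0) \<and>
        (\<exists>C1>0. \<exists>C2>0. \<exists>C3>0. \<forall>x.
           dirac alpha2 u x = V x *v u x \<and>
           norm (u x) \<le> C1 * exp (- C2 * norm x powr (2 - 2 * \<epsilon>)) \<and>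
           (x \<noteq> 0 \<longrightarrow> norm (V x) \<le> C3 * norm x powr (- \<epsilon>)))"
    using plane_case[OF assms] by metis
next
  obtain u :: "real^3 \<Rightarrow> complex^4" and V :: "real^3 \<Rightarrow> complex^4^4" and C1 C2 C3
    where uV: "smooth u" "smooth V" "\<exists>x. u x \<noteq> 0" "\<exists>x. V x \<noteq> 0" and C: "C1 > 0" "C2 > 0" "C3 > 0"
      and *: "\<And>x. dirac alpha3 u x = V x *v u x"
        "\<And>x. norm (u x) \<le> C1 * exp (- C2 * norm x powr (2 - 2 * \<epsilon>))"
        "\<And>x. norm x < 2 \<Longrightarrow> V x = 0" "\<And>x. norm (V x) \<le> C3 * norm x powr (- \<epsilon>)"
    using space_case[OF assms] by metis
  have ln2: "ln 2 ^ 3 > (0 :: real)" by simp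
  have "norm (V x) \<le> C3 / ln 2 ^ 3 * norm x powr (- \<epsilon>) * \<bar>ln (norm x)\<bar> ^ 3" for x
  proof (cases "norm x < 2")
    case True
    then show ?thesis using *(3) C ln2 by simp
  next
    case False
    then have "ln 2 \<le> \<bar>ln (norm x)\<bar>" by (intro order.trans[OF ln_mono abs_ge_self]) auto
    then have "ln 2 ^ 3 \<le> \<bar>ln (norm x)\<bar> ^ 3" by (intro power_mono) auto
    then have "C3 / ln 2 ^ 3 * norm x powr (- \<epsilon>) * ln 2 ^ 3 \<le> C3 / ln 2 ^ 3 * norm x powr (- \<epsilon>) * \<bar>ln (norm x)\<bar> ^ 3"
      using C ln2 by (intro mult_left_mono) auto
    then show ?thesis using *(4)[of x] ln2 by simp
  qed
  moreover have "C3 / ln 2 ^ 3 > 0" using C ln2 by simp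
  ultimately show "\<exists>(u :: real^3 \<Rightarrow> complex^4) (V :: real^3 \<Rightarrow> complex^4^4).
        smooth u \<and> smooth V \<and> (\<exists>x. u x \<noteq> 0) \<and> (\<exists>x. V x \<noteq> 0) \<and>
        (\<exists>C1>0. \<exists>C2>0. \<exists>C3>0. \<forall>x.
           dirac alpha3 u x = V x *v u x \<and>
           norm (u x) \<le> C1 * exp (- C2 * norm x powr (2 - 2 * \<epsilon>)) \<and>
           (x \<noteq> 0 \<longrightarrow>
              norm (V x) \<le> C3 * norm x powr (- \<epsilon>) * \<bar>ln (norm x)\<bar> ^ 3))"
    using uV C(1,2) *(1,2) by (intro exI[of _ u] exI[of _ V] conjI exI[of _ C1] exI[of _ C2] exI[of _ "C3 / ln 2 ^ 3"]) auto
qed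

end
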